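(* (1) For each $\lambda\in\mathbb N$, the set $\{t_{\mathrm{ev}}^{(n)} v^+_{2\lambda}\mid 0\le n\le 2\lambda\}$ forms the $\imath$-canonical basis for $L(2\lambda)$. Moreover, $t_{\mathrm{ev}}^{(2\lambda+1)}v^+_{2\lambda}=t_{\mathrm{ev}}^{(2\lambda)}v^+_{2\lambda}$, and $t_{\mathrm{ev}}^{(n)} v^+_{2\lambda}=0$ for $n\ge 2\lambda+2$. (2) The set $\{t_{\mathrm{ev}}^{(n)}\mid n\in\mathbb N\}$ forms the $\imath$-canonical basis for $\mathbf U^\imath$ (of even parity, i.e. relative to the modules $L(2\lambda)$, $\lambda\in\mathbb N$).
   Context: $\mathbb N=\{0,1,2,\dots\}$. $\mathbf U=\mathbf U_q(\mathfrak{sl}_2)$ is the $\mathbb Q(q)$-algebra generated by $E,F,K,K^{-1}$ with relations $KK^{-1}=K^{-1}K=1$, $EF-FE=\frac{K-K^{-1}}{q-q^{-1}}$, $KE=q^2EK$, $KF=q^{-2}FK$. For $n\in\mathbb Z$, $[n]=\frac{q^n-q^{-n}}{q-q^{-1}}$, and $[n]!=[1]\cdots[n]$ for $n\ge 0$; $F^{(n)}=F^n/[n]!$. Put $\check E=q^{-1}EK^{-1}$ and $t=\check E+F+K^{-1}$. Here $\mathbf U^\imath$ is the $\mathbb Q(q)$-subalgebra of $\mathbf U$ generated by $t$ (a polynomial algebra in $t$). The $\imath$-divided powers $t_{\mathrm{ev}}^{(n)}$ are the polynomials in $t$ determined by $t_{\mathrm{ev}}^{(0)}=1$, $t_{\mathrm{ev}}^{(1)}=t$,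 and, for $a\ge 0$: $t\cdot t_{\mathrm{ev}}^{(2a)}=[2a+1]\,t_{\mathrm{ev}}^{(2a+1)}$, $t\cdot t_{\mathrm{ev}}^{(2a+1)}=[2a+2]\,t_{\mathrm{ev}}^{(2a+2)}+[2a+1]\,t_{\mathrm{ev}}^{(2a)}$. Equivalently, $t_{\mathrm{ev}}^{(2a)}=\frac{1}{[2a]!}\prod_{i=1-a}^{a}(t-[2i-1])$ and $t_{\mathrm{ev}}^{(2a+1)}=\frac{1}{[2a+1]!}\,t\prod_{i=1-a}^{a}(t-[2i-1])$. For $\mu\in\mathbb N$, $L(\mu)$ is the simple $\mathbf U$-module of highest weight $\mu$ (dimension $\mu+1$) with highest weight vector $v^+_\mu$ (so $Ev^+_\mu=0$, $Kv^+_\mu=q^\mu v^+_\mu$); it has canonical basis $\{F^{(a)}v^+_\mu\mid 0\le a\le\mu\}$. For $\mu=2\lambda$, the bar involution $\psi_\imath$ on $L(\mu)$ is the $\mathbb Q$-linear map with $\psi_\imath(qx)=q^{-1}\psi_\imath(x)$ that fixes $t_{\mathrm{ev}}^{(n)}v^+_\mu$ for all $n\ge 0$ (equivalently, fixes $t^n v^+_\mu$ for all $n\ge 0$). The $\imath$-canonical basis $\{b^\mu_a\}_{0\le a\le\mu}$ of $L(\mu)$ is the basis characterized by: (i) $\psi_\imath(b^\mu_a)=b^\mu_a$; (ii) $b^\mu_a\in F^{(a)}v^+_\mu+\sum_{0\le r\le\mu}q^{-1}\mathbb Z[q^{-1}]F^{(r)}v^+_\mu$. The $\imath$-canonical basis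 for $\mathbf U^\imath$ of even parity is the set $\{u_a\mid a\in\mathbb N\}$ where $u_a\in\mathbf U^\imath$ is the unique element with $u_a v^+_{2\lambda}=b^{2\lambda}_a$ for all sufficiently large $\lambda\in\mathbb N$. *)

theory Defs
  imports "HOL-Library.Poly_Mapping" "HOL-Computational_Algebra.Computational_Algebra"
begin

section \<open>The field of rational functions and quantum integers\<close>

type_synonym ratfun = "rat poly fract"

definition qv :: ratfun where
  "qv = Fract [:0, 1:] 1"

definition qint :: "int \<Rightarrow> ratfun" where
  "qint n = (qv powi n - qv powi (- n)) / (qv - inverse qv)"

definition qfact :: "nat \<Rightarrow> ratfun" where
  "qfact n = (\<Prod>k = 1..n. qint (int k))"

text \<open>The subset \<open>q\<^sup>-\<^sup>1 \<int>[q\<^sup>-\<^sup>1]\<close> of the field.\<close>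

definition qinv_Zqinv :: "ratfun set" where
  "qinv_Zqinv = {inverse qv * poly (map_poly of_int p) (inverse qv) | p :: int poly. True}"


section \<open>The quantum group, by generators and relations\<close>

datatype gen = genE | genF | genK | genKinv

text \<open>The free monoid on the four generators, written additively because the product on
  \<^typ>\<open>'a \<Rightarrow>\<^sub>0 'b\<close> is convolution with respect to \<open>+\<close> on \<^typ>\<open>'a\<close>.\<close>

datatype word = Word (letters: "gen list")

instantiation word :: monoid_add
begin

definition zero_word :: word where
  "zero_word = Word []"

definition plus_word :: "word \<Rightarrow> word \<Rightarrow> word" where
  "plus_word v w = Word (letters v @ letters w)"

instance
  by standard (simp_all add: zero_word_def plus_word_def)

end

text \<open>The free associative unital algebra on the four generators.\<close>

type_synonym free_alg = "word \<Rightarrow>\<^sub>0 ratfun"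

definition const_free :: "ratfun \<Rightarrow> free_alg" where
  "const_free c = Poly_Mapping.single 0 c"

definition gen_free :: "gen \<Rightarrow> free_alg" where
  "gen_free g = Poly_Mapping.single (Word [g]) 1"

definition uq_relations :: "free_alg set" where
  "uq_relations =
    (let E = gen_free genE; F = gen_free genF; K = gen_free genK; K' = gen_free genKinv in
     {K * K' - 1,
      K' * K - 1,
      E * F - F * E - const_free (inverse (qv - inverse qv)) * (K - K'),
      K * E - const_free (qv ^ 2) * E * K,
      K * F - const_free (inverse (qv ^ 2)) * F * K})"

inductive_set uq_ideal :: "free_alg set" where
  zero: "0 \<in> uq_ideal"
| add: "x \<in> uq_ideal \<Longrightarrow> y \<in> uq_ideal \<Longrightarrow> x + y \<in> uq_ideal"
| gen: "r \<in> uq_relations \<Longrightarrow> a * r * b \<in> uq_ideal"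

lemma uq_ideal_mult_left: "x \<in> uq_ideal \<Longrightarrow> a * x \<in> uq_ideal"
proof (induction rule: uq_ideal.induct)
  case (gen r b c)
  then show ?case using uq_ideal.gen[of r "a * b" c] by (simp add: mult.assoc)
qed (auto simp: distrib_left intro: uq_ideal.intros)

lemma uq_ideal_mult_right: "x \<in> uq_ideal \<Longrightarrow> x * a \<in> uq_ideal"
proof (induction rule: uq_ideal.induct)
  case (gen r b c)
  then show ?case using uq_ideal.gen[of r b "c * a"] by (simp add: mult.assoc)
qed (auto simp: distrib_right intro: uq_ideal.intros)

lemma uq_ideal_uminus: "x \<in> uq_ideal \<Longrightarrow> - x \<in> uq_ideal"
  using uq_ideal_mult_left[of x "-1"] by simp

quotient_type uq = free_alg / "\<lambda>x y. x - y \<in> uq_ideal"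
proof (rule equivpI)
  show "reflp (\<lambda>x y. x - y \<in> uq_ideal)"
    by (auto simp: reflp_def uq_ideal.zero)
  show "symp (\<lambda>x y. x - y \<in> uq_ideal)"
    using uq_ideal_uminus by (fastforce simp: symp_def)
  show "transp (\<lambda>x y. x - y \<in> uq_ideal)"
    using uq_ideal.add by (fastforce simp: transp_def)
qed

text \<open>To see that the quotient is not the zero ring, we use the counit, i.e. the character
  killing \<open>E\<close> and \<open>F\<close> and sending \<open>K\<close> to \<open>1\<close>.\<close>

definition counit_word :: "word \<Rightarrow> ratfun" where
  "counit_word w = (if set (letters w) \<inter> {genE, genF} = {} then 1 else 0)"

definition counit_free :: "free_alg \<Rightarrow> ratfun" where
  "counit_free p = (\<Sum>w\<in>Poly_Mapping.keys p. Poly_Mapping.lookup p w * counit_word w)"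

lemma counit_free_superset:
  assumes "finite A" "Poly_Mapping.keys p \<subseteq> A"
  shows "counit_free p = (\<Sum>w\<in>A. Poly_Mapping.lookup p w * counit_word w)"
  unfolding counit_free_def
  by (rule sum.mono_neutral_left) (use assms in \<open>auto simp: in_keys_iff\<close>)

lemma counit_free_add: "counit_free (x + y) = counit_free x + counit_free y"
proof -
  let ?A = "Poly_Mapping.keys x \<union> Poly_Mapping.keys y"
  have "finite ?A" "Poly_Mapping.keys (x + y) \<subseteq> ?A"
    by (auto dest: Poly_Mapping.keys_add[THEN subsetD])
  then show ?thesis
    by (simp add: counit_free_superset[of ?A] lookup_add distrib_right sum.distrib)
qed

lemma counit_free_diff: "counit_free (x - y) = counit_free x - counit_free y"
  using counit_free_add[of "x - y" y] by simp

lemma counit_free_single: "counit_free (Poly_Mapping.single w c) = c * counit_word w"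
  by (simp add: counit_free_def)

lemma free_alg_induct [case_names single add]:
  assumes "\<And>w c. P (Poly_Mapping.single w c)"
    and "\<And>x y. P x \<Longrightarrow> P y \<Longrightarrow> P (x + y)"
  shows "P (p :: free_alg)"
proof (induction p rule: update_induct)
  case const
  then show ?case using assms(1)[of 0 0] by simp
next
  case (update p w c)
  have "Poly_Mapping.update w c p = p + Poly_Mapping.single w c"
    using update(1)
    by (intro poly_mapping_eqI) (auto simp: lookup_update lookup_add lookup_single in_keys_iff when_def)
  then show ?case using assms update by simp
qed

lemma counit_word_plus: "counit_word (v + w) = counit_word v * counit_word w"
  by (auto simp: counit_word_def plus_word_def)

lemma counit_free_mult: "counit_free (x * y) = counit_free x * counit_free y"
proof (induction x rule: free_alg_induct)
  case (single v c)
  show ?case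
    by (induction y rule: free_alg_induct)
      (simp_all add: mult_single counit_free_single counit_word_plus counit_free_add distrib_left)
qed (simp_all add: distrib_right counit_free_add)

lemma counit_free_one: "counit_free 1 = 1"
  by (simp add: single_one[symmetric] counit_free_single counit_word_def zero_word_def
      del: single_one)

lemma counit_uq_ideal: "x \<in> uq_ideal \<Longrightarrow> counit_free x = 0"
proof (induction rule: uq_ideal.induct)
  case zero
  then show ?case by (simp add: counit_free_def)
next
  case (gen r a b)
  have "counit_free r = 0"
    using gen
    by (auto simp: uq_relations_def Let_def gen_free_def const_free_def counit_free_diff
        counit_free_mult counit_free_single counit_word_def counit_free_one)
  then show ?case by (simp add: counit_free_mult)
qed (simp add: counit_free_add)

instantiation uq :: ring_1
begin

lift_definition zero_uq :: uq is 0 .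

lift_definition one_uq :: uq is 1 .

lift_definition plus_uq :: "uq \<Rightarrow> uq \<Rightarrow> uq" is "(+)"
  subgoal for a b c d
    using uq_ideal.add[of "a - b" "c - d"] by (simp add: algebra_simps)
  done

lift_definition uminus_uq :: "uq \<Rightarrow> uq" is uminus
  using uq_ideal_uminus by fastforce

lift_definition minus_uq :: "uq \<Rightarrow> uq \<Rightarrow> uq" is "(-)"
  subgoal for a b c d
    using uq_ideal.add[of "a - b" "- (c - d)"] uq_ideal_uminus[of "c - d"]
    by (simp add: algebra_simps)
  done

lift_definition times_uq :: "uq \<Rightarrow> uq \<Rightarrow> uq" is "(*)"
  subgoal for a b c d
    using uq_ideal.add[of "(a - b) * c" "b * (c - d)"]
      uq_ideal_mult_right[of "a - b" c] uq_ideal_mult_left[of "c - d" b]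
    by (simp add: algebra_simps)
  done

instance
proof
  show "(0 :: uq) \<noteq> 1"
    by transfer (use counit_uq_ideal[of "0 - 1"] counit_free_diff[of 0 1] counit_free_one in
        \<open>auto simp: counit_free_def[of 0]\<close>)
qed (transfer, simp add: algebra_simps uq_ideal.zero)+

end

lift_definition scaleU :: "ratfun \<Rightarrow> uq \<Rightarrow> uq" is "\<lambda>c x. const_free c * x"
  using uq_ideal_mult_left by (fastforce simp: right_diff_distrib[symmetric])

lift_definition gen_uq :: "gen \<Rightarrow> uq" is gen_free .

global_interpretation UQ: vector_space scaleU
proof
  fix a b :: ratfun and x y :: uq
  show "scaleU a (x + y) = scaleU a x + scaleU a y"
    by transfer (simp add: algebra_simps uq_ideal.zero)
  show "scaleU (a + b) x = scaleU a x + scaleU b x"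
    by transfer (simp add: const_free_def single_add algebra_simps uq_ideal.zero)
  show "scaleU a (scaleU b x) = scaleU (a * b) x"
    by transfer (simp add: const_free_def mult.assoc[symmetric] mult_single uq_ideal.zero)
  show "scaleU 1 x = x"
    by transfer (simp add: const_free_def uq_ideal.zero)
qed

abbreviation E :: uq where "E \<equiv> gen_uq genE"
abbreviation F :: uq where "F \<equiv> gen_uq genF"
abbreviation K :: uq where "K \<equiv> gen_uq genK"
abbreviation Kinv :: uq where "Kinv \<equiv> gen_uq genKinv"

definition F_div :: "nat \<Rightarrow> uq" where
  "F_div n = scaleU (inverse (qfact n)) (F ^ n)"


section \<open>The \<open>\<iota>\<close>quantum group and the \<open>\<iota>\<close>divided powers\<close>

definition Echeck :: uq where
  "Echeck = scaleU (inverse qv) (E * Kinv)"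

definition tU :: uq where
  "tU = Echeck + F + Kinv"

definition subalgebra :: "uq set \<Rightarrow> bool" where
  "subalgebra S \<longleftrightarrow> UQ.subspace S \<and> 1 \<in> S \<and> (\<forall>x\<in>S. \<forall>y\<in>S. x * y \<in> S)"

definition Uiota :: "uq set" where
  "Uiota = subalgebra hull {tU}"

text \<open>The two defining recurrences
  \<open>t \<cdot> t\<^sup>(\<^sup>2\<^sup>a\<^sup>) = [2a+1] t\<^sup>(\<^sup>2\<^sup>a\<^sup>+\<^sup>1\<^sup>)\<close> and
  \<open>t \<cdot> t\<^sup>(\<^sup>2\<^sup>a\<^sup>+\<^sup>1\<^sup>) = [2a+2] t\<^sup>(\<^sup>2\<^sup>a\<^sup>+\<^sup>2\<^sup>) + [2a+1] t\<^sup>(\<^sup>2\<^sup>a\<^sup>)\<close>,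
  solved for the element of highest index; in the last equation \<open>n = 2a\<close> in the first
  case and \<open>n + 1 = 2a\<close> in the second.\<close>

fun t_ev :: "nat \<Rightarrow> uq" where
  "t_ev 0 = 1"
| "t_ev (Suc 0) = tU"
| "t_ev (Suc (Suc n)) = scaleU (inverse (qint (int (n + 2))))
     (if even n then tU * t_ev (Suc n) - scaleU (qint (int (n + 1))) (t_ev n)
      else tU * t_ev (Suc n))"


section \<open>Modules over the quantum group\<close>

locale uq_module = vector_space scale
  for scale :: "ratfun \<Rightarrow> 'v::ab_group_add \<Rightarrow> 'v" +
  fixes act :: "uq \<Rightarrow> 'v \<Rightarrow> 'v"
  assumes act_add_left: "act (x + y) m = act x m + act y m"
    and act_add_right: "act x (m + m') = act x m + act x m'"
    and act_mult: "act (x * y) m = act x (act y m)"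
    and act_one: "act 1 m = m"
    and act_scale_left: "act (scaleU c x) m = scale c (act x m)"
begin

definition submodule :: "'v set \<Rightarrow> bool" where
  "submodule S \<longleftrightarrow> subspace S \<and> (\<forall>x. \<forall>m\<in>S. act x m \<in> S)"

definition simple_submodule :: "'v set \<Rightarrow> bool" where
  "simple_submodule S \<longleftrightarrow> submodule S \<and> S \<noteq> {0} \<and>
     (\<forall>T. submodule T \<and> T \<subseteq> S \<longrightarrow> T = {0} \<or> T = S)"

definition highest_weight_vector :: "nat \<Rightarrow> 'v \<Rightarrow> bool" where
  "highest_weight_vector \<mu> m \<longleftrightarrow> m \<noteq> 0 \<and> act E m = 0 \<and> act K m = scale (qv ^ \<mu>) m"

end

text \<open>The family \<open>L(\<mu>)\<close>, \<open>\<mu> \<in> \<nat>\<close>, of simple highest weight modules, in an arbitrary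
  realisation. The members of the family are carried by subspaces of one type and are
  regarded as submodules of one ambient module, for instance their direct sum.\<close>

locale simple_hw_modules = uq_module scale act
  for scale :: "ratfun \<Rightarrow> 'v::ab_group_add \<Rightarrow> 'v" and act :: "uq \<Rightarrow> 'v \<Rightarrow> 'v" +
  fixes L :: "nat \<Rightarrow> 'v set" and v :: "nat \<Rightarrow> 'v"
  assumes L_simple: "simple_submodule (L \<mu>)"
    and v_in_L: "v \<mu> \<in> L \<mu>"
    and v_highest_weight: "highest_weight_vector \<mu> (v \<mu>)"
begin

text \<open>The bar involution on \<open>L(2\<lambda>)\<close>; only the values on \<open>L(2\<lambda>)\<close> matter.\<close>

definition is_bar_involution :: "nat \<Rightarrow> ('v \<Rightarrow> 'v) \<Rightarrow> bool" where
  "is_bar_involution l \<psi> \<longleftrightarrow>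
     (\<forall>x\<in>L (2 * l). \<psi> x \<in> L (2 * l)) \<and>
     (\<forall>x\<in>L (2 * l). \<forall>y\<in>L (2 * l). \<psi> (x + y) = \<psi> x + \<psi> y) \<and>
     (\<forall>c :: rat. \<forall>x\<in>L (2 * l). \<psi> (scale (of_rat c) x) = scale (of_rat c) (\<psi> x)) \<and>
     (\<forall>x\<in>L (2 * l). \<psi> (scale qv x) = scale (inverse qv) (\<psi> x)) \<and>
     (\<forall>n. \<psi> (act (t_ev n) (v (2 * l))) = act (t_ev n) (v (2 * l)))"

definition bar_inv :: "nat \<Rightarrow> 'v \<Rightarrow> 'v" where
  "bar_inv l x = (THE y. \<exists>\<psi>. is_bar_involution l \<psi> \<and> y = \<psi> x)"

text \<open>The characterisation of the \<open>\<iota>\<close>canonical basis \<open>b 0, \<dots>, b (2\<lambda>)\<close> of \<open>L(2\<lambda>)\<close>.\<close>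

definition is_icanonical_basis :: "nat \<Rightarrow> (nat \<Rightarrow> 'v) \<Rightarrow> bool" where
  "is_icanonical_basis l b \<longleftrightarrow>
     inj_on b {..2 * l} \<and> independent (b ` {..2 * l}) \<and> span (b ` {..2 * l}) = L (2 * l) \<and>
     (\<forall>a\<le>2 * l. bar_inv l (b a) = b a) \<and>
     (\<forall>a\<le>2 * l. \<exists>c. (\<forall>r\<le>2 * l. c r \<in> qinv_Zqinv) \<and>
        b a = act (F_div a) (v (2 * l)) + (\<Sum>r\<le>2 * l. scale (c r) (act (F_div r) (v (2 * l)))))"

text \<open>The element \<open>b\<^sub>a\<close> of the unique such basis of \<open>L(2\<lambda>)\<close>, for \<open>a \<le> 2\<lambda>\<close>.\<close>

definition icanonical :: "nat \<Rightarrow> nat \<Rightarrow> 'v" where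
  "icanonical l a = (THE x. \<exists>b. is_icanonical_basis l b \<and> x = b a)"

definition lifts_icanonical :: "nat \<Rightarrow> uq \<Rightarrow> bool" where
  "lifts_icanonical a w \<longleftrightarrow>
     w \<in> Uiota \<and> (\<exists>N. \<forall>l\<ge>N. act w (v (2 * l)) = icanonical l a)"

text \<open>\<open>u\<close> is the \<open>\<iota>\<close>canonical basis of even parity of the \<open>\<iota>\<close>quantum group: a basis whose
  \<open>a\<close>-th member is the unique element lifting the \<open>b\<^sub>a\<close> of \<open>L(2\<lambda>)\<close> for all large \<open>\<lambda>\<close>.\<close>

definition is_icanonical_basis_Uiota :: "(nat \<Rightarrow> uq) \<Rightarrow> bool" where
  "is_icanonical_basis_Uiota u \<longleftrightarrow>
     inj u \<and> UQ.independent (range u) \<and> UQ.span (range u) = Uiota \<and>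
     (\<forall>a. lifts_icanonical a (u a) \<and> (\<forall>w. lifts_icanonical a w \<longrightarrow> w = u a))"

end

end

theory Submission
  imports Defs
begin

text \<open>
  Write \<open>V\<^sub>r = F\<^sup>(\<^sup>r\<^sup>)v\<close> in \<open>L(2\<lambda>)\<close>. The element \<open>t\<close> acts tridiagonally on the \<open>V\<^sub>r\<close>,
  and the whole theorem rests on a closed formula for the coefficients of
  \<open>t\<^sup>(\<^sup>n\<^sup>)v\<close> in this basis. For \<open>n = 2m\<close> or \<open>n = 2m + 1\<close> with \<open>m \<le> \<lambda>\<close>, put \<open>d = \<lambda> - m\<close>.
  With \<open>c = \<lfloor>k/2\<rfloor>\<close>, the coefficient of \<open>V\<close> at index \<open>n - k\<close> is the Gaussian binomial coefficient
  \<open>(d + c choose c)\<close> in the variable \<open>q\<^sup>-\<^sup>4\<close>, times a power of \<open>q\<^sup>-\<^sup>1\<close> with exponent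
  \<open>k(k + 1)/2\<close> for even \<open>n\<close> and \<open>k(k - 1)/2\<close> for odd \<open>n\<close>, plus \<open>2d\<close> when \<open>k\<close> is odd.
  The formula follows from the two recurrences that define the \<open>t\<^sup>(\<^sup>n\<^sup>)\<close>, by induction on \<open>n\<close>
  (\<open>odd_coeff_recurrence\<close>, \<open>even_coeff_recurrence\<close>, \<open>t_ev_expansion_aux\<close>).

  Everything else is read off from it. The coefficient at \<open>V\<^sub>n\<close> is 1, the coefficients above
  it vanish, and for \<open>n \<le> 2\<lambda>\<close> those below it lie in \<open>q\<^sup>-\<^sup>1\<int>[q\<^sup>-\<^sup>1]\<close>. So the \<open>t\<^sup>(\<^sup>n\<^sup>)v\<close> with
  \<open>n \<le> 2\<lambda>\<close> form a basis of \<open>L(2\<lambda>)\<close> of the required shape, and the bar involution fixes them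
  by definition. The semilinear map that fixes this basis also fixes the other \<open>t\<^sup>(\<^sup>n\<^sup>)v\<close>, so the
  involution exists: for \<open>n = 2\<lambda> + 1\<close> the formula gives \<open>t\<^sup>(\<^sup>n\<^sup>)v = t\<^sup>(\<^sup>2\<^sup>\<lambda>\<^sup>)v\<close>, and the recurrences
  then give 0 for \<open>n \<ge> 2\<lambda> + 2\<close>.
  Uniqueness of the \<open>\<iota>\<close>canonical basis is the usual argument: the difference of two candidates has
  bar invariant coefficients in the basis \<open>t\<^sup>(\<^sup>n\<^sup>)v\<close>, its highest nonzero coefficient
  lies in \<open>q\<^sup>-\<^sup>1\<int>[q\<^sup>-\<^sup>1]\<close> by triangularity, and no nonzero element of that set is bar invariant.

  For \<open>\<^bold>U\<^sup>\<iota>\<close>, the recurrences show that the \<open>t\<^sup>(\<^sup>n\<^sup>)\<close> span the algebra generated by \<open>t\<close>.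
  A finite combination of them that kills \<open>v\<close> in \<open>L(2\<lambda>)\<close> for all large \<open>\<lambda>\<close> is zero, because
  there the vectors involved are part of a basis. This gives both their independence and the
  uniqueness of the lifts.\<close>

section \<open>Rational functions in \<open>q\<close>\<close>

text \<open>Substitution of a rational function for the variable. The bar involution of the scalars is
  substitution of \<open>q\<^sup>-\<^sup>1\<close>, and that it is well defined on fractions amounts to \<open>q\<^sup>-\<^sup>1\<close> being
  transcendental over \<open>\<rat>\<close>.\<close>

definition qeval :: "ratfun \<Rightarrow> rat poly \<Rightarrow> ratfun" where
  "qeval x p = poly (map_poly of_rat p) x"

lemma qeval_0 [simp]: "qeval x 0 = 0"
  by (simp add: qeval_def)

lemma qeval_pCons [simp]: "qeval x (pCons a p) = of_rat a + x * qeval x p"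
  by (simp add: qeval_def map_poly_pCons)

lemma qeval_1 [simp]: "qeval x 1 = 1"
  by (simp add: one_pCons)

lemma qeval_add: "qeval x (p + r) = qeval x p + qeval x r"
  by (induction p r rule: poly_induct2) (simp_all add: of_rat_add algebra_simps)

lemma qeval_smult: "qeval x (smult c p) = of_rat c * qeval x p"
  by (induction p) (simp_all add: of_rat_mult algebra_simps)

lemma qeval_mult: "qeval x (p * r) = qeval x p * qeval x r"
  by (induction p) (simp_all add: qeval_add qeval_smult algebra_simps)

lemma qeval_monom: "qeval x (monom c n) = of_rat c * x ^ n"
  by (simp add: qeval_def map_poly_monom poly_monom)

lemma qeval_reflect_poly:
  assumes "x \<noteq> 0"
  shows "qeval x (reflect_poly p) = x ^ degree p * qeval (inverse x) p"
  using assms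
proof (induction p)
  case (pCons a p)
  then show ?case
    by (cases "p = 0") (simp_all add: reflect_poly_pCons' qeval_add qeval_monom algebra_simps)
qed simp

lemma of_rat_ratfun: "(of_rat c :: ratfun) = to_fract [:c:]"
proof (cases c)
  case (Fract a b)
  have of_int: "(of_int k :: ratfun) = to_fract [:of_int k:]" for k
  proof -
    have nat: "(of_nat n :: ratfun) = to_fract [:of_nat n:]" for n
    proof (induction n)
      case (Suc n)
      have "(of_nat (Suc n) :: ratfun) = to_fract (1 + [:of_nat n:])"
        by (simp add: Suc)
      then show ?case by (simp add: one_pCons)
    qed simp
    show ?thesis
      by (cases k rule: int_cases2) (simp_all add: nat to_fract_uminus[symmetric] del: to_fract_uminus)
  qed
  have "to_fract [:c:] * of_int b = of_int a"
    using Fract by (simp add: of_int to_fract_mult[symmetric] Fract_of_int_quotient del: to_fract_mult)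
  moreover have "of_rat c * of_int b = (of_int a :: ratfun)"
    using Fract by (simp add: of_rat_rat)
  moreover have "of_int b \<noteq> (0 :: ratfun)"
    using Fract by simp
  ultimately show ?thesis by (metis mult_right_cancel)
qed

lemma qv_eq: "qv = to_fract [:0, 1:]"
  by (simp add: qv_def to_fract_def)

lemma to_fract_eq_qeval: "to_fract p = qeval qv p"
proof (induction p)
  case (pCons a p)
  have "pCons a p = [:a:] + [:0, 1:] * p" by simp
  then show ?case
    using pCons by (metis of_rat_ratfun qeval_pCons qv_eq to_fract_add to_fract_mult)
qed simp

lemma qv_nonzero [simp]: "qv \<noteq> 0"
  by (simp add: qv_eq)

lemma qeval_qv_eq_0_iff [simp]: "qeval qv p = 0 \<longleftrightarrow> p = 0"
  by (simp flip: to_fract_eq_qeval)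

text \<open>Multiplying by a power of \<open>q\<close> turns \<open>p(q\<^sup>-\<^sup>1)\<close> into the value at \<open>q\<close> of the reflected
  polynomial, and polynomials embed into their fraction field.\<close>

lemma qeval_inverse_qv_eq_0_iff [simp]: "qeval (inverse qv) p = 0 \<longleftrightarrow> p = 0"
  using qeval_reflect_poly[of qv p] qeval_qv_eq_0_iff[of "reflect_poly p"] by auto

lemma qv_power_eq_1_iff: "qv ^ n = 1 \<longleftrightarrow> n = 0"
proof
  assume "qv ^ n = 1"
  then have "qeval qv (monom 1 n - 1) = 0"
    using qeval_add[of qv "monom 1 n - 1" 1] by (simp add: qeval_monom)
  then have "monom (1::rat) n = monom 1 0" by (simp add: monom_0 one_pCons)
  then show "n = 0" by (metis degree_monom_eq one_neq_zero)
qed simp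

lemma qv_powi_eq_1_iff: "qv powi n = 1 \<longleftrightarrow> n = 0"
  using qv_power_eq_1_iff[of "nat \<bar>n\<bar>"]
  by (auto simp: power_int_def field_simps split: if_splits)

lemma qv_powi_inj: "qv powi m = qv powi n \<longleftrightarrow> m = n"
  using qv_powi_eq_1_iff[of "m - n"] by (auto simp: power_int_diff)

lemma qv_diff_nonzero: "qv - inverse qv \<noteq> 0"
  using qv_powi_inj[of 1 "-1"] by (simp add: power_int_minus)

lemma qint_eq_0_iff: "qint n = 0 \<longleftrightarrow> n = 0"
  using qv_diff_nonzero by (auto simp: qint_def qv_powi_inj)

lemma qint_0 [simp]: "qint 0 = 0"
  by (simp add: qint_def)

lemma qint_1 [simp]: "qint 1 = 1"
  using qv_diff_nonzero by (simp add: qint_def power_int_minus)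

lemma qfact_nonzero: "qfact n \<noteq> 0"
  by (auto simp: qfact_def qint_eq_0_iff)

lemma qfact_Suc: "qfact (Suc n) = qint (int (Suc n)) * qfact n"
  by (simp add: qfact_def mult.commute)

section \<open>The bar involution of the scalars\<close>

lemma ratfun_cases:
  obtains a b where "b \<noteq> 0" "x = to_fract a / to_fract b"
  by (metis Fract_cases Fract_conv_to_fract)

text \<open>The value is the same for all ways of writing \<open>x\<close> as a fraction, see \<open>bar_quotient\<close>.\<close>

definition bar :: "ratfun \<Rightarrow> ratfun" where
  "bar x = (THE y. \<exists>a b. b \<noteq> 0 \<and> x = to_fract a / to_fract b \<and>
     y = qeval (inverse qv) a / qeval (inverse qv) b)"

lemma bar_quotient:
  assumes "b \<noteq> 0"
  shows "bar (to_fract a / to_fract b) = qeval (inverse qv) a / qeval (inverse qv) b"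
  unfolding bar_def
proof (rule the_equality)
  show "\<exists>c d. d \<noteq> 0 \<and> to_fract a / to_fract b = to_fract c / to_fract d \<and>
      qeval (inverse qv) a / qeval (inverse qv) b = qeval (inverse qv) c / qeval (inverse qv) d"
    using assms by blast
next
  fix y
  assume "\<exists>c d. d \<noteq> 0 \<and> to_fract a / to_fract b = to_fract c / to_fract d \<and>
      y = qeval (inverse qv) c / qeval (inverse qv) d"
  then obtain c d where d: "d \<noteq> 0" "to_fract a / to_fract b = to_fract c / to_fract d"
    and y: "y = qeval (inverse qv) c / qeval (inverse qv) d" by blast
  then have "to_fract (c * b) = to_fract (a * d)"
    using assms by (simp add: field_simps)
  then have "c * b = a * d" by (simp only: to_fract_eq_iff)
  then have "qeval (inverse qv) c * qeval (inverse qv) b = qeval (inverse qv) a * qeval (inverse qv) d"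
    by (metis qeval_mult)
  then show "y = qeval (inverse qv) a / qeval (inverse qv) b"
    using d assms by (simp add: y frac_eq_eq mult.commute)
qed

lemma bar_add: "bar (x + y) = bar x + bar y"
proof -
  obtain a b c d where "b \<noteq> 0" "x = to_fract a / to_fract b" "d \<noteq> 0" "y = to_fract c / to_fract d"
    by (metis ratfun_cases)
  moreover from this have "x + y = to_fract (a * d + c * b) / to_fract (b * d)"
    by (simp add: field_simps)
  ultimately show ?thesis
    using bar_quotient[of "b * d" "a * d + c * b"]
    by (simp add: bar_quotient qeval_add qeval_mult add_frac_eq del: to_fract_add to_fract_mult)
qed

lemma bar_mult: "bar (x * y) = bar x * bar y"
proof -
  obtain a b c d where "b \<noteq> 0" "x = to_fract a / to_fract b" "d \<noteq> 0" "y = to_fract c / to_fract d"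
    by (metis ratfun_cases)
  moreover from this have "x * y = to_fract (a * c) / to_fract (b * d)"
    by simp
  ultimately show ?thesis
    using bar_quotient[of "b * d" "a * c"]
    by (simp add: bar_quotient qeval_mult del: to_fract_mult)
qed

lemma bar_to_fract: "bar (to_fract p) = qeval (inverse qv) p"
  using bar_quotient[of 1 p] by simp

lemma bar_of_rat [simp]: "bar (of_rat c) = of_rat c"
  using bar_to_fract[of "[:c:]"] by (simp flip: of_rat_ratfun)

lemma bar_0 [simp]: "bar 0 = 0"
  using bar_of_rat[of 0] by simp

lemma bar_1 [simp]: "bar 1 = 1"
  using bar_of_rat[of 1] by simp

lemma bar_qv [simp]: "bar qv = inverse qv"
  by (subst (1) qv_eq) (simp add: bar_to_fract)

lemma bar_inverse_qv [simp]: "bar (inverse qv) = qv"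
  using bar_mult[of qv "inverse qv"] by (simp add: field_simps)

lemma bar_qeval: "bar (qeval x p) = qeval (bar x) p"
  by (induction p) (simp_all add: bar_add bar_mult)

definition Zqinv :: "ratfun set" where
  "Zqinv = range (\<lambda>p :: int poly. poly (map_poly of_int p) (inverse qv))"

lemma Zqinv_1 [simp]: "1 \<in> Zqinv"
  unfolding Zqinv_def by (rule range_eqI[of _ _ 1]) simp

lemma Zqinv_add:
  assumes "x \<in> Zqinv" "y \<in> Zqinv"
  shows "x + y \<in> Zqinv"
proof -
  have "map_poly of_int (p + r) = map_poly of_int p + (map_poly of_int r :: ratfun poly)" for p r
    by (intro poly_eqI) (simp add: coeff_map_poly)
  then show ?thesis
    using assms unfolding Zqinv_def by (auto simp flip: poly_add) (metis rangeI)
qed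

lemma Zqinv_mult_power: "x \<in> Zqinv \<Longrightarrow> inverse qv ^ n * x \<in> Zqinv"
proof (induction n)
  case (Suc n)
  then obtain p where "inverse qv ^ n * x = poly (map_poly of_int p) (inverse qv)"
    by (auto simp: Zqinv_def)
  then have "inverse qv ^ Suc n * x = poly (map_poly of_int (pCons 0 p)) (inverse qv)"
    by (simp add: map_poly_pCons mult.assoc)
  then show ?case unfolding Zqinv_def by blast
qed simp

lemma qinv_Zqinv_eq: "qinv_Zqinv = (*) (inverse qv) ` Zqinv"
  by (auto simp: qinv_Zqinv_def Zqinv_def)

lemma power_mult_Zqinv:
  assumes "n > 0" "x \<in> Zqinv"
  shows "inverse qv ^ n * x \<in> qinv_Zqinv"
proof -
  have "inverse qv ^ n * x = inverse qv * (inverse qv ^ (n - 1) * x)"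
    using assms by (simp add: mult.assoc[symmetric] flip: power_Suc)
  then show ?thesis using assms Zqinv_mult_power by (auto simp: qinv_Zqinv_eq)
qed

lemma qinv_Zqinv_0: "0 \<in> qinv_Zqinv"
  unfolding qinv_Zqinv_def by (auto intro!: exI[of _ 0])

text \<open>The bar involution maps \<open>q\<^sup>-\<^sup>1\<int>[q\<^sup>-\<^sup>1]\<close> to \<open>q\<int>[q]\<close>, and the two sets share
  only 0. This is what makes canonical bases unique.\<close>

lemma qinv_Zqinv_bar_fixed:
  assumes "x \<in> qinv_Zqinv" "bar x = x"
  shows "x = 0"
proof -
  obtain p :: "int poly" where x: "x = inverse qv * poly (map_poly of_int p) (inverse qv)"
    using assms(1) by (auto simp: qinv_Zqinv_def)
  define P where "P = map_poly rat_of_int p"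
  have "map_poly of_int p = (map_poly of_rat P :: ratfun poly)"
    by (simp add: P_def map_poly_map_poly o_def)
  then have x: "x = inverse qv * qeval (inverse qv) P"
    by (simp add: x qeval_def)
  then have "bar x = qv * qeval qv P"
    by (simp add: bar_mult bar_qeval)
  with assms(2) x have "qv * qeval qv P = inverse qv * qeval (inverse qv) P" by simp
  then have "qv ^ (degree P + 2) * qeval qv P = qv ^ degree P * qeval (inverse qv) P"
    by (simp add: field_simps power2_eq_square)
  (* The equation q P(q) = P(1/q) / q, with denominators cleared: the left side is divisible by a
     higher power of q than the degree of the right side allows. *)
  then have "qeval qv (monom 1 (degree P + 2) * P) = qeval qv (reflect_poly P)"
    by (simp add: qeval_mult qeval_monom qeval_reflect_poly)
  then have eq: "monom 1 (degree P + 2) * P = reflect_poly P"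
    by (simp only: to_fract_eq_iff flip: to_fract_eq_qeval)
  have "P = 0"
  proof (rule ccontr)
    assume "P \<noteq> 0"
    then have "degree (monom 1 (degree P + 2) * P) = degree P + 2 + degree P"
      by (subst degree_mult_eq) (auto simp: degree_monom_eq)
    with eq degree_reflect_poly_le[of P] show False by simp
  qed
  then show ?thesis by (simp add: x)
qed

lemma Zqinv_uminus:
  assumes "x \<in> Zqinv"
  shows "- x \<in> Zqinv"
proof -
  have "map_poly of_int (- p) = - (map_poly of_int p :: ratfun poly)" for p
    by (intro poly_eqI) (simp add: coeff_map_poly)
  then show ?thesis
    using assms unfolding Zqinv_def by (auto simp flip: poly_minus) (metis rangeI)
qed

lemma qinv_Zqinv_diff:
  assumes "x \<in> qinv_Zqinv" "y \<in> qinv_Zqinv"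
  shows "x - y \<in> qinv_Zqinv"
proof -
  obtain a b where "a \<in> Zqinv" "b \<in> Zqinv" "x = inverse qv * a" "y = inverse qv * b"
    using assms by (auto simp: qinv_Zqinv_eq)
  moreover from this have "a + - b \<in> Zqinv" "x - y = inverse qv * (a + - b)"
    by (simp_all only: Zqinv_add Zqinv_uminus) (simp add: algebra_simps)
  ultimately show ?thesis by (auto simp: qinv_Zqinv_eq)
qed

lemma powi_mult_Zqinv:
  assumes "n > 0" "x \<in> Zqinv"
  shows "qv powi (- n) * x \<in> qinv_Zqinv"
proof -
  have "qv powi (- n) = inverse qv ^ nat n"
    using assms by (simp add: power_int_def)
  then show ?thesis using assms power_mult_Zqinv[of "nat n" x] by simp
qed

section \<open>Gaussian binomial coefficients and the recurrences of the coefficients\<close>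

text \<open>The Gaussian binomial coefficient \<open>(d + c choose c)\<close> in the variable \<open>x\<close>. Pascal's rule as
  the definition makes it evident that the values are polynomials in \<open>x\<close> with integer
  coefficients.\<close>

fun gauss_binom :: "'a::comm_ring_1 \<Rightarrow> nat \<Rightarrow> nat \<Rightarrow> 'a" where
  "gauss_binom x d 0 = 1"
| "gauss_binom x 0 (Suc c) = 1"
| "gauss_binom x (Suc d) (Suc c) = gauss_binom x d (Suc c) + x ^ Suc d * gauss_binom x (Suc d) c"

lemma gauss_binom_0 [simp]: "gauss_binom x 0 c = 1"
  by (cases c) simp_all

text \<open>The quotient of two neighbouring Gaussian binomial coefficients, without division. Pascal's
  rule reduces it to the corresponding statement for a step in \<open>d\<close>, which is proved along the way.\<close>

lemma gauss_binom_Suc_right: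
  "(1 - x ^ Suc c) * gauss_binom x d (Suc c) = (1 - x ^ (d + Suc c)) * gauss_binom x d c"
proof (induction d arbitrary: c)
  case (Suc d)
  note IH = Suc
  have left: "(1 - x ^ Suc d) * gauss_binom x (Suc d) c = (1 - x ^ (d + Suc c)) * gauss_binom x d c" for c
  proof (induction c)
    case (Suc c)
    have "(1 - x ^ Suc d) * gauss_binom x (Suc d) (Suc c)
        = (1 - x ^ Suc d) * gauss_binom x d (Suc c) + x ^ Suc d * ((1 - x ^ Suc d) * gauss_binom x (Suc d) c)"
      by (simp add: algebra_simps)
    also have "(1 - x ^ Suc d) * gauss_binom x (Suc d) c = (1 - x ^ Suc c) * gauss_binom x d (Suc c)"
      using Suc IH[of c] by simp
    finally show ?case by (simp add: algebra_simps power_add)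
  qed (simp add: algebra_simps)
  have "(1 - x ^ Suc c) * gauss_binom x (Suc d) (Suc c)
      = (1 - x ^ Suc c) * gauss_binom x d (Suc c) + (x ^ Suc d - x ^ (d + Suc (Suc c))) * gauss_binom x (Suc d) c"
    by (simp add: algebra_simps power_add)
  also have "(1 - x ^ Suc c) * gauss_binom x d (Suc c) = (1 - x ^ Suc d) * gauss_binom x (Suc d) c"
    using Suc left by simp
  finally show ?case by (simp add: algebra_simps)
qed simp

lemma gauss_binom_Zqinv: "gauss_binom (inverse qv ^ 4) d c \<in> Zqinv"
  by (induction "inverse qv ^ 4" d c rule: gauss_binom.induct)
    (auto intro!: Zqinv_add Zqinv_mult_power simp flip: power_mult power_add power_Suc)

text \<open>The variable is \<open>q\<^sup>-\<^sup>4\<close>, and the value is 0 for negative \<open>c\<close>: this makes the relations below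
  valid for all integers \<open>c\<close>, so that the first terms of the recurrences need no separate
  treatment.\<close>

definition gauss :: "nat \<Rightarrow> int \<Rightarrow> ratfun" where
  "gauss d c = (if c < 0 then 0 else gauss_binom (inverse qv ^ 4) d (nat c))"

lemma gauss_Zqinv: "c \<ge> 0 \<Longrightarrow> gauss d c \<in> Zqinv"
  by (simp add: gauss_def gauss_binom_Zqinv)

lemma inverse_qv_pow4: "(inverse qv ^ 4) ^ n = qv powi (- 4 * int n)"
  by (simp add: power_int_minus power_int_mult power_inverse flip: power_mult)

lemma gauss_ratio:
  "(1 - qv powi (- 4 * c)) * gauss d c = (1 - qv powi (- 4 * (int d + c))) * gauss d (c - 1)"
proof -
  consider "c < 0" | "c = 0" | n where "c = int (Suc n)"
    by (metis int_cases2 linorder_neqE_linordered_idom not_less_iff_gr_or_eq nonneg_int_cases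
        gr0_implies_Suc of_nat_0_less_iff zero_less_imp_eq_int)
  then show ?thesis
  proof cases
    case 3
    then show ?thesis
      using gauss_binom_Suc_right[of "inverse qv ^ 4" n d]
      unfolding inverse_qv_pow4 by (simp add: gauss_def nat_add_distrib algebra_simps)
  qed (simp_all add: gauss_def)
qed

lemma gauss_pascal:
  "gauss (Suc d) c = gauss d c + qv powi (- 4 * (int d + 1)) * gauss (Suc d) (c - 1)"
proof -
  consider "c < 0" | "c = 0" | n where "c = int (Suc n)"
    by (metis int_cases2 linorder_neqE_linordered_idom not_less_iff_gr_or_eq nonneg_int_cases
        gr0_implies_Suc of_nat_0_less_iff zero_less_imp_eq_int)
  then show ?thesis
  proof cases
    case 3
    then show ?thesis
      using gauss_binom.simps(3)[of "inverse qv ^ 4" d n]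
      unfolding inverse_qv_pow4 by (simp add: gauss_def nat_add_distrib algebra_simps)
  qed (simp_all add: gauss_def)
qed

text \<open>The coefficients of \<open>t\<^sup>(\<^sup>2\<^sup>m\<^sup>)v\<close> and of \<open>t\<^sup>(\<^sup>2\<^sup>m\<^sup>+\<^sup>1\<^sup>)v\<close> in \<open>L(2m + 2d)\<close>; the number \<open>k\<close> is the
  distance of the index from the leading one.\<close>

definition even_coeff :: "nat \<Rightarrow> int \<Rightarrow> ratfun" where
  "even_coeff d k = qv powi (- (k * (k + 1) div 2 + (if odd k then 2 * int d else 0))) * gauss d (k div 2)"

definition odd_coeff :: "nat \<Rightarrow> int \<Rightarrow> ratfun" where
  "odd_coeff d k = qv powi (- (k * (k - 1) div 2 + (if odd k then 2 * int d else 0))) * gauss d (k div 2)"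

text \<open>All exponents are written relative to \<open>c(2c - 1)\<close>, the only quadratic one. The recurrences
  thereby become identities between rational functions of \<open>q\<close>, \<open>q\<^sup>m\<close>, \<open>q\<^sup>c\<close> and \<open>q\<^sup>d\<close>.\<close>

lemma coeff_at_parity:
  fixes c :: int
  defines "T \<equiv> c * (2 * c - 1)"
  shows "even_coeff d (2 * c) = qv powi (- T - 2 * c) * gauss d c"
    and "even_coeff d (2 * c + 1) = qv powi (- T - 4 * c - 1 - 2 * int d) * gauss d c"
    and "even_coeff d (2 * c - 1) = qv powi (- T - 2 * int d) * gauss d (c - 1)"
    and "even_coeff d (2 * c - 2) = qv powi (- T + 2 * c - 1) * gauss d (c - 1)"
    and "odd_coeff d (2 * c) = qv powi (- T) * gauss d c"
    and "odd_coeff d (2 * c + 1) = qv powi (- T - 2 * c - 2 * int d) * gauss d c"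
    and "odd_coeff d (2 * c - 1) = qv powi (- T + 2 * c - 1 - 2 * int d) * gauss d (c - 1)"
    and "odd_coeff d (2 * c - 2) = qv powi (- T + 4 * c - 3) * gauss d (c - 1)"
proof -
  have div: "k div 2 = j" if "k = 2 * j \<or> k = 2 * j + 1" for k j :: int
    using that by auto
  have d: "2 * c * (2 * c + 1) div 2 = T + 2 * c"
    "(2 * c + 1) * (2 * c + 1 + 1) div 2 = T + 4 * c + 1"
    "(2 * c - 1) * (2 * c - 1 + 1) div 2 = T"
    "(2 * c - 2) * (2 * c - 2 + 1) div 2 = T - 2 * c + 1"
    "2 * c * (2 * c - 1) div 2 = T"
    "(2 * c + 1) * (2 * c + 1 - 1) div 2 = T + 2 * c"
    "(2 * c - 1) * (2 * c - 1 - 1) div 2 = T - 2 * c + 1"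
    "(2 * c - 2) * (2 * c - 2 - 1) div 2 = T - 4 * c + 3"
    by (rule div; simp add: T_def algebra_simps)+
  have powi_cong: "qv powi i * g = qv powi j * g" if "i = j" for i j g
    using that by simp
  have h: "2 * c div 2 = c" "(2 * c + 1) div 2 = c" "(2 * c - 1) div 2 = c - 1" "(2 * c - 2) div 2 = c - 1"
    by presburger+
  show "even_coeff d (2 * c) = qv powi (- T - 2 * c) * gauss d c"
    "even_coeff d (2 * c + 1) = qv powi (- T - 4 * c - 1 - 2 * int d) * gauss d c"
    "even_coeff d (2 * c - 1) = qv powi (- T - 2 * int d) * gauss d (c - 1)"
    "even_coeff d (2 * c - 2) = qv powi (- T + 2 * c - 1) * gauss d (c - 1)"
    "odd_coeff d (2 * c) = qv powi (- T) * gauss d c"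
    "odd_coeff d (2 * c + 1) = qv powi (- T - 2 * c - 2 * int d) * gauss d c"
    "odd_coeff d (2 * c - 1) = qv powi (- T + 2 * c - 1 - 2 * int d) * gauss d (c - 1)"
    "odd_coeff d (2 * c - 2) = qv powi (- T + 4 * c - 3) * gauss d (c - 1)"
    unfolding even_coeff_def odd_coeff_def d h by (rule powi_cong, simp)+
qed

lemma qv_powi_numeral_mult: "qv powi (numeral n * i) = (qv powi i) ^ numeral n"
  by (metis mult.commute power_int_mult power_int_numeral)

lemmas qv_powi_split = power_int_add power_int_diff power_int_minus qv_powi_numeral_mult

text \<open>The coefficient of \<open>F\<^sup>(\<^sup>r\<^sup>)v\<close> in \<open>t \<cdot> t\<^sup>(\<^sup>2\<^sup>m\<^sup>)v = [2m+1] t\<^sup>(\<^sup>2\<^sup>m\<^sup>+\<^sup>1\<^sup>)v\<close>: the three terms come from the parts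
  \<open>F\<close>, \<open>K\<^sup>-\<^sup>1\<close> and \<open>q\<^sup>-\<^sup>1EK\<^sup>-\<^sup>1\<close> of \<open>t\<close>. For each parity of \<open>k\<close> only two Gaussian binomial
  coefficients occur, and \<open>gauss_ratio\<close> is the only relation between them that is needed.\<close>

lemma odd_coeff_recurrence:
  fixes m d :: nat and k :: int
  defines "r \<equiv> 2 * int m + 1 - k"
  shows "qint (2 * int m + 1) * odd_coeff d k =
     qint r * even_coeff d k + qv powi (2 * r - 2 * int m - 2 * int d) * even_coeff d (k - 1)
     + qv powi (2 * r + 1 - 2 * int m - 2 * int d) * qint (2 * int m + 2 * int d - r) * even_coeff d (k - 2)"
proof -
  define D where "D = qv - inverse qv"
  define a c b e where "a = qv ^ m" and "c = k div 2" and "b = qv powi c" and "e = qv ^ d"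
  define t where "t = qv powi (c * (2 * c - 1))"
  define H H' where "H = gauss d c" and "H' = gauss d (c - 1)"
  have nz: "D \<noteq> 0" "a \<noteq> 0" "b \<noteq> 0" "e \<noteq> 0" "qv \<noteq> 0" "t \<noteq> 0"
    using qv_diff_nonzero by (simp_all add: D_def a_def b_def e_def t_def)
  have rel: "(1 - inverse (b ^ 4)) * H = (1 - inverse (e ^ 4 * b ^ 4)) * H'"
    using gauss_ratio[of c d] by (simp add: H_def H'_def b_def e_def qv_powi_split divide_inverse)
  have rel': "e ^ 4 * (b ^ 4 - 1) * H = (e ^ 4 * b ^ 4 - 1) * H'"
    using rel nz by (simp add: divide_simps mult_ac)
  have D: "D * qv = qv ^ 2 - 1"
    by (simp add: D_def algebra_simps power2_eq_square)
  show ?thesis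
  proof (cases "even k")
    case True
    then have k: "k = 2 * c" by (simp add: c_def)
    show ?thesis
      unfolding r_def k coeff_at_parity
      (* Both sides are linear in H and H'; modulo rel' they agree as rational functions. *)
      apply (simp add: qint_def qv_powi_split
          flip: D_def a_def b_def e_def t_def H_def H'_def)
      using nz apply (simp add: divide_simps)
      using rel' D apply algebra
      done
  next
    case False
    then have k: "k = 2 * c + 1" by (simp add: c_def)
    have k': "2 * c + 1 - 1 = 2 * c" "2 * c + 1 - 2 = 2 * c - 1" by simp_all
    show ?thesis
      unfolding r_def k coeff_at_parity k'
      (* Both sides are linear in H and H'; modulo rel' they agree as rational functions. *)
      apply (simp add: qint_def qv_powi_split
          flip: D_def a_def b_def e_def t_def H_def H'_def)
      using nz apply (simp add: divide_simps)
      using rel' D apply algebra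
      done
  qed
qed

text \<open>The coefficient of \<open>F\<^sup>(\<^sup>r\<^sup>)v\<close> in
  \<open>t \<cdot> t\<^sup>(\<^sup>2\<^sup>m\<^sup>+\<^sup>1\<^sup>)v = [2m+2] t\<^sup>(\<^sup>2\<^sup>m\<^sup>+\<^sup>2\<^sup>)v + [2m+1] t\<^sup>(\<^sup>2\<^sup>m\<^sup>)v\<close>, in \<open>L(2m + 2(d + 1))\<close>. Here \<open>t\<^sup>(\<^sup>2\<^sup>m\<^sup>+\<^sup>2\<^sup>)\<close>
  brings in the coefficients for \<open>d\<close> in place of \<open>d + 1\<close>; Pascal's rule eliminates them.\<close>

lemma even_coeff_recurrence:
  fixes m d :: nat and k :: int
  defines "r \<equiv> 2 * int m + 2 - k"
  shows "qint (2 * int m + 2) * even_coeff d k + qint (2 * int m + 1) * even_coeff (Suc d) (k - 2) =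
     qint r * odd_coeff (Suc d) k + qv powi (2 * r - 2 * int m - 2 * int (Suc d)) * odd_coeff (Suc d) (k - 1)
     + qv powi (2 * r + 1 - 2 * int m - 2 * int (Suc d)) * qint (2 * int m + 2 * int (Suc d) - r)
       * odd_coeff (Suc d) (k - 2)"
proof -
  define D where "D = qv - inverse qv"
  define a c b e where "a = qv ^ m" and "c = k div 2" and "b = qv powi c" and "e = qv ^ Suc d"
  define t where "t = qv powi (c * (2 * c - 1))"
  define H H' G where "H = gauss (Suc d) c" and "H' = gauss (Suc d) (c - 1)" and "G = gauss d c"
  have nz: "D \<noteq> 0" "a \<noteq> 0" "b \<noteq> 0" "e \<noteq> 0" "qv \<noteq> 0" "t \<noteq> 0"
    using qv_diff_nonzero by (simp_all add: D_def a_def b_def e_def t_def)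
  have rel: "(1 - inverse (b ^ 4)) * H = (1 - inverse (e ^ 4 * b ^ 4)) * H'"
    using gauss_ratio[of c "Suc d"]
    by (simp add: H_def H'_def b_def e_def qv_powi_split power_mult_distrib divide_inverse)
  have "H = G + inverse (e ^ 4) * H'"
    using gauss_pascal[of d c]
    by (simp add: H_def H'_def G_def e_def qv_powi_split power_mult_distrib divide_inverse)
  then have G: "G = H - inverse (e ^ 4) * H'" by simp
  have d: "qv ^ d = e / qv" by (simp add: e_def)
  have rel': "e ^ 4 * (b ^ 4 - 1) * H = (e ^ 4 * b ^ 4 - 1) * H'"
    using rel nz by (simp add: divide_simps mult_ac)
  have D: "D * qv = qv ^ 2 - 1"
    by (simp add: D_def algebra_simps power2_eq_square)
  show ?thesis
  proof (cases "even k")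
    case True
    then have k: "k = 2 * c" by (simp add: c_def)
    show ?thesis
      unfolding r_def k coeff_at_parity
      (* As before, once G is eliminated in favour of H and H'. *)
      apply (simp add: qint_def qv_powi_split G d
          del: of_nat_Suc power_Suc
          flip: D_def a_def b_def e_def t_def H_def H'_def G_def)
      using nz apply (simp add: divide_simps)
      using rel' D apply algebra
      done
  next
    case False
    then have k: "k = 2 * c + 1" by (simp add: c_def)
    have k': "2 * c + 1 - 1 = 2 * c" "2 * c + 1 - 2 = 2 * c - 1" by simp_all
    show ?thesis
      unfolding r_def k coeff_at_parity k'
      (* As before, once G is eliminated in favour of H and H'. *)
      apply (simp add: qint_def qv_powi_split G d
          del: of_nat_Suc power_Suc
          flip: D_def a_def b_def e_def t_def H_def H'_def G_def)
      using nz apply (simp add: divide_simps)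
      using rel' D apply algebra
      done
  qed
qed

lemma gauss_neg: "c < 0 \<Longrightarrow> gauss d c = 0"
  by (simp add: gauss_def)

lemma even_coeff_neg: "k < 0 \<Longrightarrow> even_coeff d k = 0" and odd_coeff_neg: "k < 0 \<Longrightarrow> odd_coeff d k = 0"
  by (simp_all add: even_coeff_def odd_coeff_def gauss_neg)

lemma even_coeff_0 [simp]: "even_coeff d 0 = 1" and odd_coeff_0 [simp]: "odd_coeff d 0 = 1"
  by (simp_all add: even_coeff_def odd_coeff_def gauss_def)

lemma even_coeff_mem:
  assumes "k > 0"
  shows "even_coeff d k \<in> qinv_Zqinv"
proof -
  have "2 * 1 \<le> k * (k + 1)"
    using mult_mono[of 1 k 2 "k + 1"] assms by simp
  then have "k * (k + 1) div 2 > 0" by linarith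
  then show ?thesis
    unfolding even_coeff_def using assms by (intro powi_mult_Zqinv gauss_Zqinv) auto
qed

text \<open>For \<open>k = 1\<close> the coefficient is \<open>q\<^sup>-\<^sup>2\<^sup>d\<close>, which is why \<open>d\<close> has to be positive.\<close>

lemma odd_coeff_mem:
  assumes "k > 0" "d > 0"
  shows "odd_coeff d k \<in> qinv_Zqinv"
proof -
  have "k * (k - 1) div 2 + (if odd k then 2 * int d else 0) > 0"
  proof (cases "k = 1")
    case False
    have "2 * 1 \<le> k * (k - 1)"
      using mult_mono[of 2 k 1 "k - 1"] assms False by simp
    then have "k * (k - 1) div 2 > 0" by linarith
    then show ?thesis by simp
  qed (use assms in simp)
  then show ?thesis
    unfolding odd_coeff_def using assms by (intro powi_mult_Zqinv gauss_Zqinv) auto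
qed

text \<open>Behind \<open>t\<^sup>(\<^sup>2\<^sup>\<lambda>\<^sup>+\<^sup>1\<^sup>)v = t\<^sup>(\<^sup>2\<^sup>\<lambda>\<^sup>)v\<close>: for \<open>d = 0\<close> all Gaussian binomial coefficients are 1.\<close>

lemma odd_coeff_0_eq_even_coeff_0:
  assumes "k \<ge> 0"
  shows "odd_coeff 0 (k + 1) = even_coeff 0 k"
proof -
  have eq: "(k + 1) * (k + 1 - 1) = k * (k + 1)" by simp
  show ?thesis
    using assms unfolding odd_coeff_def even_coeff_def gauss_def eq by simp
qed

text \<open>The coefficient of \<open>F\<^sup>(\<^sup>r\<^sup>)v\<close> in \<open>t\<^sup>(\<^sup>n\<^sup>)v\<close>, in \<open>L(2l)\<close>.\<close>

definition t_coeff :: "nat \<Rightarrow> nat \<Rightarrow> nat \<Rightarrow> ratfun" where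
  "t_coeff l n r = (if even n then even_coeff else odd_coeff) (l - n div 2) (int n - int r)"

lemma t_coeff_diag [simp]: "t_coeff l n n = 1"
  by (simp add: t_coeff_def)

lemma t_coeff_upper: "n < r \<Longrightarrow> t_coeff l n r = 0"
  by (simp add: t_coeff_def even_coeff_neg odd_coeff_neg)

lemma t_coeff_lower:
  assumes "r < n" "n \<le> 2 * l"
  shows "t_coeff l n r \<in> qinv_Zqinv"
proof (cases "even n")
  case False
  then have "n div 2 < l" using assms by presburger
  then show ?thesis using assms False by (simp add: t_coeff_def odd_coeff_mem)
qed (use assms in \<open>simp add: t_coeff_def even_coeff_mem\<close>)

text \<open>Unitriangularity of the coefficients, in the form in which it is used: for a combination of
  the \<open>t\<^sup>(\<^sup>k\<^sup>)v\<close> with \<open>k \<le> n\<close>, the coefficient of \<open>F\<^sup>(\<^sup>n\<^sup>)v\<close> is that of \<open>t\<^sup>(\<^sup>n\<^sup>)v\<close>.\<close>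

lemma sum_t_coeff_top:
  assumes "n \<le> M" "\<And>k. n < k \<Longrightarrow> k \<le> M \<Longrightarrow> a k = 0"
  shows "(\<Sum>k\<le>M. a k * t_coeff l k n) = a n"
proof -
  have "a k * t_coeff l k n = (if k = n then a n else 0)" if "k \<in> {..M}" for k
    using that assms(2)[of k] by (cases k n rule: linorder_cases) (auto simp: t_coeff_upper)
  then have "(\<Sum>k\<le>M. a k * t_coeff l k n) = (\<Sum>k\<le>M. if k = n then a n else 0)"
    by (rule sum.cong[OF refl])
  then show ?thesis using assms(1) by simp
qed

section \<open>Indexed families in vector spaces\<close>

lemma downward_induct [consumes 1, case_names top]:
  fixes M :: nat
  assumes "n \<le> M" and step: "\<And>n. n \<le> M \<Longrightarrow> (\<And>k. n < k \<Longrightarrow> k \<le> M \<Longrightarrow> P k) \<Longrightarrow> P n"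
  shows "P n"
  using \<open>n \<le> M\<close>
proof (induction "M - n" arbitrary: n rule: less_induct)
  case less
  show ?case
  proof (rule step[OF less.prems])
    show "P k" if "n < k" "k \<le> M" for k
      using that by (intro less.hyps) simp_all
  qed
qed

context vector_space
begin

lemma span_imageE:
  assumes "y \<in> span (x ` S)"
  obtains A c where "finite A" "A \<subseteq> S" "y = (\<Sum>i\<in>A. scale (c i) (x i))"
proof -
  obtain T c where T: "finite T" "T \<subseteq> x ` S" and y: "y = (\<Sum>b\<in>T. scale (c b) b)"
    using assms by (auto simp: span_explicit)
  obtain A where A: "A \<subseteq> S" "inj_on x A" "T = x ` A"
    using T(2) by (auto simp: subset_image_inj)
  show thesis
    using T(1) A by (intro that[of A "\<lambda>i. c (x i)"]) (auto simp: y sum.reindex finite_image_iff)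
qed

lemma span_image_finiteE:
  assumes "finite S" "y \<in> span (x ` S)"
  obtains c where "y = (\<Sum>i\<in>S. scale (c i) (x i))"
proof -
  obtain A c where A: "finite A" "A \<subseteq> S" and y: "y = (\<Sum>i\<in>A. scale (c i) (x i))"
    using assms(2) by (rule span_imageE)
  have "y = (\<Sum>i\<in>S. scale (if i \<in> A then c i else 0) (x i))"
    unfolding y using assms(1) A(2) by (intro sum.mono_neutral_cong_left) auto
  then show thesis by (rule that)
qed

lemma independent_imageI:
  assumes zero: "\<And>A a i. finite A \<Longrightarrow> A \<subseteq> I \<Longrightarrow> (\<Sum>i\<in>A. scale (a i) (x i)) = 0 \<Longrightarrow> i \<in> A \<Longrightarrow> a i = 0"
  shows "inj_on x I" and "independent (x ` I)"
proof -
  show "inj_on x I"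
  proof (rule inj_onI, rule ccontr)
    fix i j assume "i \<in> I" "j \<in> I" "x i = x j" "i \<noteq> j"
    then show False
      using zero[of "{i, j}" "\<lambda>k. if k = i then 1 else - 1" i] by simp
  qed
  show "independent (x ` I)"
  proof
    assume "dependent (x ` I)"
    then obtain S u b where S: "finite S" "S \<subseteq> x ` I" "b \<in> S" "u b \<noteq> 0"
        "(\<Sum>w\<in>S. scale (u w) w) = 0"
      by (auto simp: dependent_explicit)
    then obtain A where A: "A \<subseteq> I" "inj_on x A" "S = x ` A"
      by (auto simp: subset_image_inj)
    moreover obtain i where "i \<in> A" "b = x i" using S A by auto
    ultimately show False
      using zero[of A "\<lambda>i. u (x i)" i] S by (simp add: sum.reindex finite_image_iff)
  qed
qed

end

section \<open>The quantum group and the algebra generated by \<open>t\<close>\<close>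

lemma const_free_commute: "const_free c * x = x * const_free c"
  by (induction x rule: free_alg_induct)
    (simp_all add: const_free_def mult_single mult.commute distrib_left distrib_right)

lemma scaleU_mult_left: "scaleU c x * y = scaleU c (x * y)"
  by transfer (simp add: mult.assoc uq_ideal.zero)

lemma scaleU_mult_right: "x * scaleU c y = scaleU c (x * y)"
proof -
  have "u * (const_free c * v) = const_free c * (u * v)" for u v
    by (simp add: const_free_commute[of c u] flip: mult.assoc)
  then show ?thesis by transfer (simp add: uq_ideal.zero)
qed

lemma uq_relation:
  assumes "r \<in> uq_relations"
  shows "r \<in> uq_ideal"
  using uq_ideal.gen[OF assms, of 1 1] by simp

lemma Kinv_K: "Kinv * K = 1"
  by transfer (rule uq_relation, simp add: uq_relations_def Let_def)

lemma E_F: "E * F = F * E + scaleU (inverse (qv - inverse qv)) (K - Kinv)"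
  by transfer (simp add: diff_diff_eq[symmetric], rule uq_relation, simp add: uq_relations_def Let_def)

lemma K_F: "K * F = scaleU (inverse (qv ^ 2)) (F * K)"
  by transfer (rule uq_relation, simp add: uq_relations_def Let_def mult.assoc)

lemma uq_induct [case_names one gen add scale]:
  assumes "P 1"
    and gen: "\<And>g x. P x \<Longrightarrow> P (gen_uq g * x)"
    and add: "\<And>x y. P x \<Longrightarrow> P y \<Longrightarrow> P (x + y)"
    and scale: "\<And>c x. P x \<Longrightarrow> P (scaleU c x)"
  shows "P x"
proof (induction x rule: uq.abs_induct)
  fix p
  show "P (abs_uq p)"
  proof (induction p rule: free_alg_induct)
    case (single w c)
    have "P (abs_uq (Poly_Mapping.single (Word ws) 1))" for ws
    proof (induction ws)
      case Nil
      then show ?case using \<open>P 1\<close> by (simp add: one_uq_def flip: zero_word_def)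
    next
      case (Cons g ws)
      have "Poly_Mapping.single (Word (g # ws)) 1 = gen_free g * Poly_Mapping.single (Word ws) 1"
        by (simp add: gen_free_def mult_single plus_word_def)
      then show ?case
        using gen[OF Cons, of g] by (simp add: gen_uq.abs_eq times_uq.abs_eq)
    qed
    from scale[OF this, of c "letters w"] show ?case
      by (simp add: scaleU.abs_eq const_free_def mult_single)
  next
    case (add x y)
    then show ?case using assms(3) by (simp flip: plus_uq.abs_eq)
  qed
qed

lemma t_ev_even_step:
  "tU * t_ev (2 * m) = scaleU (qint (2 * int m + 1)) (t_ev (2 * m + 1))"
proof (cases m)
  case (Suc j)
  have "qint (2 * int m + 1) \<noteq> 0" by (simp add: qint_eq_0_iff)
  then show ?thesis by (simp add: Suc add_ac)
qed simp

lemma t_ev_odd_step: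
  "tU * t_ev (2 * m + 1) =
     scaleU (qint (2 * int m + 2)) (t_ev (2 * m + 2)) + scaleU (qint (2 * int m + 1)) (t_ev (2 * m))"
proof -
  have int: "int (Suc (Suc (2 * m))) = 2 * int m + 2" "int (Suc (2 * m)) = 2 * int m + 1"
    by simp_all
  have "t_ev (Suc (Suc (2 * m))) = scaleU (inverse (qint (int (Suc (Suc (2 * m))))))
      (tU * t_ev (Suc (2 * m)) - scaleU (qint (int (Suc (2 * m)))) (t_ev (2 * m)))"
    by simp
  then have "t_ev (2 * m + 2) = scaleU (inverse (qint (2 * int m + 2)))
      (tU * t_ev (2 * m + 1) - scaleU (qint (2 * int m + 1)) (t_ev (2 * m)))"
    by (simp only: int add_2_eq_Suc' Suc_eq_plus1[symmetric])
  moreover have "qint (2 * int m + 2) \<noteq> 0"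
    by (simp add: qint_eq_0_iff)
  ultimately show ?thesis
    by (simp only: UQ.scale_scale right_inverse UQ.scale_one diff_add_cancel simp_thms)
qed

lemma t_ev_in_subalgebra:
  assumes S: "subalgebra S" and tU: "tU \<in> S"
  shows "t_ev n \<in> S"
proof (induction n rule: t_ev.induct)
  case 1
  then show ?case using S by (simp add: subalgebra_def)
next
  case 2
  then show ?case using tU by simp
next
  case (3 n)
  have "tU * t_ev (Suc n) \<in> S"
    using S tU 3 unfolding subalgebra_def by (cases "even n") auto
  then show ?case
    using S 3 unfolding subalgebra_def by (auto intro!: UQ.subspace_scale UQ.subspace_diff)
qed

text \<open>The defining recurrences express \<open>t \<cdot> t\<^sup>(\<^sup>n\<^sup>)\<close> by the \<open>\<iota>\<close>divided powers.\<close>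

lemma tU_mult_span_t_ev:
  assumes "x \<in> UQ.span (range t_ev)"
  shows "tU * x \<in> UQ.span (range t_ev)"
  using assms
proof (induction rule: UQ.span_induct_alt)
  case base
  then show ?case by (simp add: UQ.span_zero)
next
  case (step c y z)
  have "tU * t_ev n \<in> UQ.span (range t_ev)" for n
  proof (cases "even n")
    case True
    then obtain m where "n = 2 * m" by blast
    then show ?thesis
      using t_ev_even_step[of m] by (simp only:) (intro UQ.span_scale UQ.span_base rangeI)
  next
    case False
    then obtain m where "n = 2 * m + 1" by (rule oddE)
    then show ?thesis
      using t_ev_odd_step[of m] by (simp only:) (intro UQ.span_add UQ.span_scale UQ.span_base rangeI)
  qed
  then show ?case
    using step by (auto simp: distrib_left scaleU_mult_right intro!: UQ.span_add UQ.span_scale)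
qed

text \<open>As \<open>t\<^sup>(\<^sup>n\<^sup>)\<close> is a polynomial in \<open>t\<close>, stability of the span under multiplication by \<open>t\<close>
  implies stability under multiplication by each \<open>t\<^sup>(\<^sup>n\<^sup>)\<close>.\<close>

lemma subalgebra_span_t_ev: "subalgebra (UQ.span (range t_ev))"
proof -
  let ?S = "UQ.span (range t_ev)"
  have t_ev: "t_ev n * x \<in> ?S" if "x \<in> ?S" for n x
    using that
  proof (induction n arbitrary: x rule: t_ev.induct)
    case (3 n)
    have "tU * t_ev (Suc n) * x \<in> ?S"
      using 3 tU_mult_span_t_ev[of "t_ev (Suc n) * x"] by (cases "even n") (auto simp: mult.assoc)
    then show ?case
      using 3 by (auto simp: scaleU_mult_left left_diff_distrib intro!: UQ.span_scale UQ.span_diff)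
  qed (simp_all add: tU_mult_span_t_ev)
  have "x * y \<in> ?S" if "x \<in> ?S" "y \<in> ?S" for x y
    using that(1)
  proof (induction rule: UQ.span_induct_alt)
    case base
    then show ?case by (simp add: UQ.span_zero)
  next
    case (step c u w)
    then show ?case
      using t_ev[OF that(2)]
      by (auto simp: distrib_right scaleU_mult_left intro!: UQ.span_add UQ.span_scale)
  qed
  moreover have "t_ev 0 \<in> ?S"
    by (rule UQ.span_base) (rule rangeI)
  ultimately show ?thesis
    by (simp add: subalgebra_def)
qed

lemma span_t_ev: "UQ.span (range t_ev) = Uiota"
proof (rule antisym)
  have "UQ.span (range t_ev) \<subseteq> S" if "subalgebra S" "tU \<in> S" for S
    using that t_ev_in_subalgebra[OF that]
    by (intro UQ.span_minimal) (auto simp: subalgebra_def)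
  then show "UQ.span (range t_ev) \<subseteq> Uiota"
    unfolding Uiota_def hull_def by auto
  have "t_ev 1 \<in> UQ.span (range t_ev)"
    by (rule UQ.span_base) (rule rangeI)
  then show "Uiota \<subseteq> UQ.span (range t_ev)"
    unfolding Uiota_def by (intro hull_minimal subalgebra_span_t_ev) simp
qed

section \<open>Vectors of highest weight in modules\<close>

context uq_module
begin

lemma act_zero_right [simp]: "act x 0 = 0"
  using act_add_right[of x 0 0] by simp

lemma act_zero_left [simp]: "act 0 m = 0"
  using act_add_left[of 0 0 m] by simp

lemma act_scale_right: "act x (scale c m) = scale c (act x m)"
proof -
  have "act x (scale c m) = act (x * scaleU c 1) m"
    by (simp add: act_mult act_scale_left act_one)
  then show ?thesis by (simp add: scaleU_mult_right act_scale_left)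
qed

lemma act_diff_left: "act (x - y) m = act x m - act y m"
  using act_add_left[of "x - y" y m] by (simp add: algebra_simps)

lemma act_sum_right: "act x (\<Sum>i\<in>A. f i) = (\<Sum>i\<in>A. act x (f i))"
  by (induction A rule: infinite_finite_induct) (simp_all add: act_add_right)

lemma act_sum_left: "act (\<Sum>i\<in>A. f i) m = (\<Sum>i\<in>A. act (f i) m)"
  by (induction A rule: infinite_finite_induct) (simp_all add: act_add_left)

lemma submoduleI:
  assumes S: "subspace S" and gen: "\<And>g m. m \<in> S \<Longrightarrow> act (gen_uq g) m \<in> S"
  shows "submodule S"
proof -
  have "act x m \<in> S" if "m \<in> S" for x m
    using that
    by (induction x rule: uq_induct)
      (simp_all add: act_one act_mult gen act_add_left act_scale_left
        subspace_add[OF S] subspace_scale[OF S])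
  with S show ?thesis by (simp add: submodule_def)
qed

lemma submodule_spanI:
  assumes "\<And>g m. m \<in> B \<Longrightarrow> act (gen_uq g) m \<in> span B"
  shows "submodule (span B)"
proof (rule submoduleI)
  show "act (gen_uq g) m \<in> span B" if "m \<in> span B" for g m
    using that
    by (induction rule: span_induct_alt)
      (simp_all add: act_add_right act_scale_right assms span_zero span_add span_scale)
qed simp

text \<open>Eigenvectors for different eigenvalues are independent: applying \<open>y - ev j\<close> removes the
  \<open>j\<close>-th summand. The summands may be zero, so that the lemma can also be applied before it is
  known which of them are nonzero.\<close>

lemma eigenvectors_sum_eq_0:
  assumes "finite A" "inj_on ev A" "\<And>i. i \<in> A \<Longrightarrow> act y (x i) = scale (ev i) (x i)"
    and "(\<Sum>i\<in>A. x i) = 0" "i \<in> A"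
  shows "x i = 0"
  using assms
proof (induction A arbitrary: x i)
  case (insert j A)
  define x' where "x' i = scale (ev i - ev j) (x i)" for i
  have "x' i = act y (x i) - scale (ev j) (x i)" if "i \<in> insert j A" for i
    using insert.prems(2)[OF that] by (simp add: x'_def scale_left_diff_distrib)
  then have "(\<Sum>i\<in>insert j A. x' i) = (\<Sum>i\<in>insert j A. act y (x i) - scale (ev j) (x i))"
    by (rule sum.cong[OF refl])
  also have "\<dots> = act y (\<Sum>i\<in>insert j A. x i) - scale (ev j) (\<Sum>i\<in>insert j A. x i)"
    by (simp only: sum_subtractf act_sum_right scale_sum_right)
  also have "\<dots> = 0"
    using insert.prems(3) by simp
  finally have "(\<Sum>i\<in>A. x' i) = 0"
    using insert.hyps by (simp add: x'_def)
  note sum_x' = this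
  have "x' i = 0" if "i \<in> A" for i
  proof (rule insert.IH[OF _ _ sum_x' that])
    show "inj_on ev A"
      using insert.prems(1) by simp
    show "act y (x' k) = scale (ev k) (x' k)" if "k \<in> A" for k
      using insert.prems(2)[of k] that by (simp add: x'_def act_scale_right mult.commute)
  qed
  then have A: "x i = 0" if "i \<in> A" for i
    using insert.prems(1) insert.hyps(2) that by (auto simp: x'_def inj_on_def)
  then show ?case
    using insert.prems(3,4) insert.hyps by (auto simp: A)
qed simp

context
  fixes w :: 'v and z :: ratfun
  assumes z: "z \<noteq> 0" and E_w: "act E w = 0" and K_w: "act K w = scale z w"
begin

lemma K_F_power: "act K (act (F ^ n) w) = scale (z * qv powi (- 2 * int n)) (act (F ^ n) w)"
proof (induction n)
  case 0
  then show ?case by (simp add: act_one K_w)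
next
  case (Suc n)
  have "act K (act (F ^ Suc n) w) = act (K * F) (act (F ^ n) w)"
    by (simp add: act_mult)
  also have "\<dots> = scale (inverse (qv ^ 2) * (z * qv powi (- 2 * int n))) (act (F ^ Suc n) w)"
    by (simp add: K_F act_scale_left act_mult Suc act_scale_right)
  also have "inverse (qv ^ 2) * (z * qv powi (- 2 * int n)) = z * qv powi (- 2 * int (Suc n))"
    by (simp add: power_int_diff power_int_minus field_simps)
  finally show ?case .
qed

lemma Kinv_F_power:
  "act Kinv (act (F ^ n) w) = scale (inverse z * qv powi (2 * int n)) (act (F ^ n) w)"
proof -
  let ?x = "act (F ^ n) w" and ?c = "z * qv powi (- 2 * int n)"
  have "?x = act Kinv (act K ?x)"
    by (metis Kinv_K act_mult act_one)
  then have "?x = scale ?c (act Kinv ?x)"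
    by (simp add: K_F_power act_scale_right)
  then have "scale (inverse ?c) ?x = act Kinv ?x"
    using z by (metis (no_types, lifting) left_inverse mult_eq_0_iff power_int_eq_0_iff qv_nonzero scale_one scale_scale)
  then show ?thesis by (simp add: power_int_minus)
qed

text \<open>Moving \<open>E\<close> past \<open>F\<^sup>n\<close> adds up the values of \<open>(K - K\<^sup>-\<^sup>1)/(q - q\<^sup>-\<^sup>1)\<close> on \<open>w, Fw, \<dots>, F\<^sup>n\<^sup>-\<^sup>1w\<close>; the
  sum has the stated product form, as one sees by induction.\<close>

lemma E_F_power:
  "act E (act (F ^ n) w) = scale (qint (int n) *
     ((z * qv powi (1 - int n) - inverse z * qv powi (int n - 1)) / (qv - inverse qv)))
     (act (F ^ (n - 1)) w)"
proof (induction n)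
  case 0
  then show ?case by (simp add: act_one E_w)
next
  case (Suc n)
  define D where "D = qv - inverse qv"
  define c where "c n = qint (int n) * ((z * qv powi (1 - int n) - inverse z * qv powi (int n - 1)) / D)" for n
  let ?x = "act (F ^ n) w"
  have "act F (act E ?x) = scale (c n) ?x"
    using Suc by (cases n) (simp_all add: act_scale_right c_def D_def act_mult)
  moreover have "act E (act (F ^ Suc n) w) = act (E * F) ?x"
    by (simp add: act_mult)
  ultimately have "act E (act (F ^ Suc n) w) = scale (c n) ?x
      + scale (inverse D) (act K ?x - act Kinv ?x)"
    by (simp add: E_F act_add_left act_scale_left act_diff_left act_mult D_def)
  also have "\<dots> = scale (c n + inverse D * (z * qv powi (- 2 * int n) - inverse z * qv powi (2 * int n))) ?x"
    by (simp add: K_F_power Kinv_F_power scale_left_distrib scale_left_diff_distrib scale_right_diff_distrib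
        right_diff_distrib)
  also have "c n + inverse D * (z * qv powi (- 2 * int n) - inverse z * qv powi (2 * int n)) = c (Suc n)"
  proof -
    (* An identity between rational functions of q, q^n and z. *)
    define a where "a = qv ^ n"
    have nz: "D \<noteq> 0" "a \<noteq> 0" using qv_diff_nonzero by (simp_all add: a_def D_def)
    have D: "D * qv = qv ^ 2 - 1"
      by (simp add: D_def algebra_simps power2_eq_square)
    show ?thesis
      using nz z apply (simp add: c_def qint_def qv_powi_split flip: a_def D_def)
      apply (simp add: divide_simps)
      using D apply algebra
      done
  qed
  finally show ?case by (simp add: c_def D_def)
qed

text \<open>For \<open>N = 0\<close> this is the submodule generated by \<open>w\<close>; the case \<open>N > 0\<close> is what rules out
  nonzero vectors \<open>F\<^sup>Nw\<close> of highest weight in a simple module.\<close>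

lemma F_tail_submodule:
  assumes "N = 0 \<or> act E (act (F ^ N) w) = 0"
  shows "submodule (span ((\<lambda>n. act (F ^ n) w) ` {N..}))" (is "submodule (span ?B)")
proof (rule submodule_spanI)
  fix g m
  assume "m \<in> ?B"
  then obtain n where n: "n \<ge> N" and m: "m = act (F ^ n) w" by auto
  show "act (gen_uq g) m \<in> span ?B"
  proof (cases g)
    case genE
    show ?thesis
    proof (cases "n > N")
      case True
      then have "act (F ^ (n - 1)) w \<in> ?B" by auto
      then show ?thesis by (simp add: genE m E_F_power span_scale span_base)
    next
      case False
      then have "act E m = 0" using assms n by (auto simp: m act_one E_w)
      then show ?thesis by (simp add: genE span_zero)
    qed
  next
    case genF
    have "act (F ^ Suc n) w \<in> ?B" using n by (intro imageI) simp
    then show ?thesis by (simp add: genF m span_base act_mult)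
  next
    case genK
    then show ?thesis using \<open>m \<in> ?B\<close> by (simp add: m K_F_power span_scale span_base)
  next
    case genKinv
    then show ?thesis using \<open>m \<in> ?B\<close> by (simp add: m Kinv_F_power span_scale span_base)
  qed
qed

end

end

section \<open>The simple modules\<close>

context simple_hw_modules
begin

abbreviation V :: "nat \<Rightarrow> nat \<Rightarrow> 'v" where
  "V \<mu> r \<equiv> act (F_div r) (v \<mu>)"

lemma V_eq: "V \<mu> r = scale (inverse (qfact r)) (act (F ^ r) (v \<mu>))"
  by (simp add: F_div_def act_scale_left)

lemma v_nonzero: "v \<mu> \<noteq> 0" and E_v: "act E (v \<mu>) = 0" and K_v: "act K (v \<mu>) = scale (qv ^ \<mu>) (v \<mu>)"
  using v_highest_weight[of \<mu>] by (simp_all add: highest_weight_vector_def)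

lemmas K_F_power_v = K_F_power[OF power_not_zero[OF qv_nonzero] E_v K_v]
  and Kinv_F_power_v = Kinv_F_power[OF power_not_zero[OF qv_nonzero] E_v K_v]
  and E_F_power_v = E_F_power[OF power_not_zero[OF qv_nonzero] E_v K_v]
  and F_tail_submodule_v = F_tail_submodule[OF power_not_zero[OF qv_nonzero] E_v K_v]

lemma submodule_L: "submodule (L \<mu>)" and subspace_L: "subspace (L \<mu>)"
  using L_simple[of \<mu>] by (simp_all add: simple_submodule_def submodule_def)

lemma act_in_L: "m \<in> L \<mu> \<Longrightarrow> act x m \<in> L \<mu>"
  using submodule_L by (simp add: submodule_def)

lemma L_eq_submodule:
  assumes "submodule T" "T \<subseteq> L \<mu>" "x \<in> T" "x \<noteq> 0"
  shows "T = L \<mu>"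
  using assms L_simple[of \<mu>] unfolding simple_submodule_def by blast

lemma L_eq_span_F_tail:
  assumes "N = 0 \<or> act E (act (F ^ N) (v \<mu>)) = 0" "act (F ^ N) (v \<mu>) \<noteq> 0"
  shows "L \<mu> = span ((\<lambda>n. act (F ^ n) (v \<mu>)) ` {N..})"
proof (rule L_eq_submodule[symmetric, OF F_tail_submodule_v[OF assms(1)] _ _ assms(2)])
  show "span ((\<lambda>n. act (F ^ n) (v \<mu>)) ` {N..}) \<subseteq> L \<mu>"
    by (intro span_minimal subspace_L) (auto intro: act_in_L v_in_L)
  show "act (F ^ N) (v \<mu>) \<in> span ((\<lambda>n. act (F ^ n) (v \<mu>)) ` {N..})"
    by (intro span_base imageI) simp
qed

lemma F_power_sum_eq_0:
  assumes "finite A" "(\<Sum>n\<in>A. scale (c n) (act (F ^ n) (v \<mu>))) = 0" "n \<in> A"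
  shows "scale (c n) (act (F ^ n) (v \<mu>)) = 0"
proof (rule eigenvectors_sum_eq_0[OF assms(1) _ _ assms(2,3)])
  show "inj_on (\<lambda>n. qv ^ \<mu> * qv powi (- 2 * int n)) A"
    using qv_powi_inj by (auto simp: inj_on_def)
  show "act K (scale (c i) (act (F ^ i) (v \<mu>)))
      = scale (qv ^ \<mu> * qv powi (- 2 * int i)) (scale (c i) (act (F ^ i) (v \<mu>)))" for i
    by (simp add: act_scale_right K_F_power_v mult_ac)
qed

text \<open>By the formula for \<open>E F\<^sup>n v\<close>, the vector \<open>F\<^sup>\<mu>\<^sup>+\<^sup>1v\<close> is killed by \<open>E\<close>. If it were nonzero, the
  powers \<open>F\<^sup>n v\<close> with \<open>n > \<mu>\<close> would span all of \<open>L(\<mu>)\<close> by simplicity, and \<open>v\<close> would be a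
  combination of eigenvectors of \<open>K\<close> with eigenvalues other than its own.\<close>

lemma F_power_Suc_top: "act (F ^ Suc \<mu>) (v \<mu>) = 0"
proof (rule ccontr)
  let ?x = "\<lambda>n. act (F ^ n) (v \<mu>)"
  assume nz: "?x (Suc \<mu>) \<noteq> 0"
  have "act E (?x (Suc \<mu>)) = 0"
    unfolding E_F_power_v by (simp add: power_int_minus flip: power_int_of_nat)
  then have "v \<mu> \<in> span (?x ` {Suc \<mu>..})"
    using L_eq_span_F_tail[OF _ nz] v_in_L by blast
  then obtain A c where A: "finite A" "A \<subseteq> {Suc \<mu>..}" and c: "v \<mu> = (\<Sum>n\<in>A. scale (c n) (?x n))"
    by (rule span_imageE)
  define c' where "c' n = (if n = 0 then - 1 else c n)" for n
  have "0 \<notin> A" using A by auto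
  then have "(\<Sum>n\<in>A. scale (c' n) (?x n)) = (\<Sum>n\<in>A. scale (c n) (?x n))"
    by (intro sum.cong) (auto simp: c'_def)
  then have "(\<Sum>n\<in>insert 0 A. scale (c' n) (?x n)) = 0"
    using A \<open>0 \<notin> A\<close> c by (simp add: c'_def act_one)
  then have "scale (c' 0) (?x 0) = 0"
    using F_power_sum_eq_0[of "insert 0 A" c' \<mu> 0] A by simp
  then show False
    using v_nonzero by (simp add: c'_def act_one)
qed

lemma F_power_eq_0: "n > \<mu> \<Longrightarrow> act (F ^ n) (v \<mu>) = 0"
proof (induction n rule: less_induct)
  case (less n)
  show ?case
  proof (cases "n = Suc \<mu>")
    case True
    then show ?thesis by (simp only: F_power_Suc_top)
  next
    case False
    then have "act (F ^ (n - 1)) (v \<mu>) = 0" using less by simp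
    moreover have "F ^ n = F * F ^ (n - 1)" using less.prems by (cases n) simp_all
    ultimately show ?thesis by (simp add: act_mult)
  qed
qed

lemma V_0 [simp]: "V \<mu> 0 = v \<mu>"
  by (simp add: V_eq qfact_def act_one)

lemma V_eq_0: "r > \<mu> \<Longrightarrow> V \<mu> r = 0"
  by (simp add: V_eq F_power_eq_0)

lemma F_V: "act F (V \<mu> r) = scale (qint (int r + 1)) (V \<mu> (Suc r))"
proof -
  have "qint (int r + 1) \<noteq> 0" by (simp add: qint_eq_0_iff)
  then show ?thesis
    by (simp add: V_eq act_scale_right qfact_Suc act_mult add.commute)
qed

lemma Kinv_V: "act Kinv (V \<mu> r) = scale (qv powi (2 * int r - int \<mu>)) (V \<mu> r)"
  by (simp add: V_eq act_scale_right Kinv_F_power_v power_int_diff divide_inverse mult_ac)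

lemma E_V: "act E (V \<mu> (Suc r)) = scale (qint (int \<mu> - int r)) (V \<mu> r)"
proof -
  have nz: "qint (int (Suc r)) \<noteq> 0" by (simp add: qint_eq_0_iff)
  have "(qv ^ \<mu> * qv powi (1 - int (Suc r)) - inverse (qv ^ \<mu>) * qv powi (int (Suc r) - 1))
      / (qv - inverse qv) = qint (int \<mu> - int r)"
    by (simp add: qint_def power_int_diff power_int_minus field_simps)
  then show ?thesis
    using nz by (simp add: V_eq act_scale_right E_F_power_v qfact_Suc del: power_Suc of_nat_Suc)
qed

text \<open>By \<open>E_V\<close>, the element \<open>E\<close> leads back from \<open>V \<mu> r\<close> to the highest weight vector with nonzero
  factors as long as \<open>r \<le> \<mu>\<close>.\<close>

lemma V_nonzero: "r \<le> \<mu> \<Longrightarrow> V \<mu> r \<noteq> 0"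
proof (induction r)
  case 0
  then show ?case by (simp add: v_nonzero)
next
  case (Suc r)
  then have "scale (qint (int \<mu> - int r)) (V \<mu> r) \<noteq> 0" by (simp add: qint_eq_0_iff)
  then show ?case using E_V[where r = r and \<mu> = \<mu>] by auto
qed

lemma V_sum_eq_0:
  assumes "(\<Sum>r\<le>\<mu>. scale (c r) (V \<mu> r)) = 0" "r \<le> \<mu>"
  shows "c r = 0"
proof -
  have "scale (c r * inverse (qfact r)) (act (F ^ r) (v \<mu>)) = 0"
    using assms F_power_sum_eq_0[of "{..\<mu>}" "\<lambda>r. c r * inverse (qfact r)" \<mu> r] by (simp add: V_eq)
  then have "scale (c r) (V \<mu> r) = 0" by (simp add: V_eq)
  then show ?thesis using V_nonzero[OF assms(2)] by simp
qed

lemma span_V: "span (V \<mu> ` {..\<mu>}) = L \<mu>"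
proof (rule antisym)
  show "span (V \<mu> ` {..\<mu>}) \<subseteq> L \<mu>"
    by (intro span_minimal subspace_L) (auto intro: act_in_L v_in_L)
  have "act (F ^ n) (v \<mu>) \<in> span (V \<mu> ` {..\<mu>})" for n
  proof (cases "n \<le> \<mu>")
    case True
    then have "scale (qfact n) (V \<mu> n) \<in> span (V \<mu> ` {..\<mu>})"
      by (intro span_scale span_base) auto
    then show ?thesis by (simp add: V_eq qfact_nonzero)
  qed (simp add: F_power_eq_0 span_zero)
  then have "span ((\<lambda>n. act (F ^ n) (v \<mu>)) ` {0..}) \<subseteq> span (V \<mu> ` {..\<mu>})"
    by (intro span_minimal) auto
  moreover have "act (F ^ 0) (v \<mu>) \<noteq> 0"
    by (simp add: act_one v_nonzero)
  ultimately show "L \<mu> \<subseteq> span (V \<mu> ` {..\<mu>})"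
    using L_eq_span_F_tail[of 0 \<mu>] by simp
qed

lemma tU_V:
  "act tU (V \<mu> r) = scale (qint (int r + 1)) (V \<mu> (Suc r)) + scale (qv powi (2 * int r - int \<mu>)) (V \<mu> r)
     + (if r = 0 then 0 else scale (qv powi (2 * int r - 1 - int \<mu>) * qint (int \<mu> + 1 - int r)) (V \<mu> (r - 1)))"
proof (cases r)
  case 0
  then show ?thesis
    using F_V[where r = 0 and \<mu> = \<mu>] Kinv_V[where r = 0 and \<mu> = \<mu>]
    by (simp add: tU_def Echeck_def act_add_left act_scale_left act_mult act_scale_right E_v)
next
  case (Suc j)
  have "2 * int r - 1 - int \<mu> = 2 * int r - int \<mu> - 1"
    by simp
  moreover have "qv powi (i - 1) = inverse qv * qv powi i" for i
    by (simp add: power_int_diff divide_inverse)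
  ultimately have pow: "qv powi (2 * int r - 1 - int \<mu>) = inverse qv * qv powi (2 * int r - int \<mu>)"
    by (simp only:)
  have E: "act E (V \<mu> r) = scale (qint (int \<mu> + 1 - int r)) (V \<mu> (r - 1))"
    using E_V[where r = j and \<mu> = \<mu>] by (simp add: Suc)
  have "act tU (V \<mu> r) = scale (inverse qv) (act E (act Kinv (V \<mu> r))) + act F (V \<mu> r) + act Kinv (V \<mu> r)"
    by (simp only: tU_def Echeck_def act_add_left act_scale_left act_mult)
  also have "\<dots> = scale (qint (int r + 1)) (V \<mu> (Suc r)) + scale (qv powi (2 * int r - int \<mu>)) (V \<mu> r)
      + scale (qv powi (2 * int r - 1 - int \<mu>) * qint (int \<mu> + 1 - int r)) (V \<mu> (r - 1))"
    by (simp only: F_V Kinv_V act_scale_right E pow scale_scale mult.assoc add_ac)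
  finally show ?thesis
    by (simp add: Suc)
qed

text \<open>The conventions at the ends are harmless: the value \<open>c (r - 1)\<close> at \<open>r = 0\<close> comes with the factor
  \<open>[0]\<close>, and \<open>c (Suc r)\<close> at \<open>r = \<mu>\<close> with \<open>[\<mu> - \<mu>]\<close>.\<close>

lemma tU_sum_V:
  "act tU (\<Sum>r\<le>\<mu>. scale (c r) (V \<mu> r)) =
     (\<Sum>r\<le>\<mu>. scale (qint (int r) * c (r - 1) + qv powi (2 * int r - int \<mu>) * c r
        + qv powi (2 * int r + 1 - int \<mu>) * qint (int \<mu> - int r) * c (Suc r)) (V \<mu> r))"
proof -
  have up: "(\<Sum>r\<le>\<mu>. scale (c r * qint (int r + 1)) (V \<mu> (Suc r)))
      = (\<Sum>r\<le>\<mu>. scale (qint (int r) * c (r - 1)) (V \<mu> r))"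
  proof -
    have "(\<Sum>r\<le>\<mu>. scale (qint (int r) * c (r - 1)) (V \<mu> r))
        = (\<Sum>r\<le>Suc \<mu>. scale (qint (int r) * c (r - 1)) (V \<mu> r))"
      by (simp add: V_eq_0)
    also have "\<dots> = (\<Sum>r\<le>\<mu>. scale (qint (int (Suc r)) * c r) (V \<mu> (Suc r)))"
      by (subst sum.atMost_Suc_shift) simp
    finally show ?thesis by (simp add: mult.commute add.commute)
  qed
  have down: "(\<Sum>r\<le>\<mu>. if r = 0 then 0 else
        scale (c r * (qv powi (2 * int r - 1 - int \<mu>) * qint (int \<mu> + 1 - int r))) (V \<mu> (r - 1)))
      = (\<Sum>r\<le>\<mu>. scale (qv powi (2 * int r + 1 - int \<mu>) * qint (int \<mu> - int r) * c (Suc r)) (V \<mu> r))"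
    (is "(\<Sum>r\<le>\<mu>. ?f r) = (\<Sum>r\<le>\<mu>. ?g r)")
  proof -
    have "(\<Sum>r\<le>\<mu>. ?f r) = (\<Sum>r\<le>Suc \<mu>. ?f r)" by simp
    also have "\<dots> = (\<Sum>r\<le>\<mu>. ?f (Suc r))" by (subst sum.atMost_Suc_shift) simp
    also have "\<dots> = (\<Sum>r\<le>\<mu>. ?g r)" by (intro sum.cong) (simp_all add: algebra_simps)
    finally show ?thesis .
  qed
  have "act tU (\<Sum>r\<le>\<mu>. scale (c r) (V \<mu> r)) =
     (\<Sum>r\<le>\<mu>. scale (c r * qint (int r + 1)) (V \<mu> (Suc r)) + scale (qv powi (2 * int r - int \<mu>) * c r) (V \<mu> r)
      + (if r = 0 then 0 else
        scale (c r * (qv powi (2 * int r - 1 - int \<mu>) * qint (int \<mu> + 1 - int r))) (V \<mu> (r - 1))))"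
    unfolding act_sum_right act_scale_right tU_V
    by (intro sum.cong) (simp_all add: scale_right_distrib mult.commute)
  then show ?thesis
    by (simp only: sum.distrib up down scale_left_distrib)
qed

section \<open>Expansion of the \<open>\<iota>\<close>divided powers\<close>

abbreviation T :: "nat \<Rightarrow> nat \<Rightarrow> 'v" where
  "T l n \<equiv> act (t_ev n) (v (2 * l))"

text \<open>Each recurrence determines the next vector because quantum integers \<open>[n]\<close> with \<open>n > 0\<close> are
  invertible. The odd case at \<open>m\<close> follows from the even one at \<open>m\<close> even for \<open>m = \<lambda>\<close>, whereas the
  even case at \<open>m + 1\<close> uses \<open>m < \<lambda>\<close>.\<close>

lemma t_ev_expansion_aux:
  assumes "m \<le> l"
  shows "T l (2 * m) = (\<Sum>r\<le>2 * l. scale (even_coeff (l - m) (2 * int m - int r)) (V (2 * l) r))"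
    and "T l (2 * m + 1) = (\<Sum>r\<le>2 * l. scale (odd_coeff (l - m) (2 * int m + 1 - int r)) (V (2 * l) r))"
proof -
  have odd: "T l (2 * m + 1) = (\<Sum>r\<le>2 * l. scale (odd_coeff (l - m) (2 * int m + 1 - int r)) (V (2 * l) r))"
    if "m \<le> l" "T l (2 * m) = (\<Sum>r\<le>2 * l. scale (even_coeff (l - m) (2 * int m - int r)) (V (2 * l) r))" for m
  proof -
    let ?z = "qint (2 * int m + 1)" and ?c = "\<lambda>r. even_coeff (l - m) (2 * int m - int r)"
    have coeff: "qint (int r) * ?c (r - 1) + qv powi (2 * int r - int (2 * l)) * ?c r
        + qv powi (2 * int r + 1 - int (2 * l)) * qint (int (2 * l) - int r) * ?c (Suc r)
        = ?z * odd_coeff (l - m) (2 * int m + 1 - int r)" for r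
    proof -
      define d where "d = l - m"
      have l: "int (2 * l) = 2 * int m + 2 * int d" using that(1) by (simp add: d_def)
      have i: "2 * int m + 1 - (2 * int m + 1 - int r) = int r"
        "2 * int m - int r = 2 * int m + 1 - int r - 1"
        "2 * int m - int (Suc r) = 2 * int m + 1 - int r - 2" by simp_all
      have pred: "qint (int r) * even_coeff d (2 * int m - int (r - 1)) = qint (int r) * even_coeff d (2 * int m + 1 - int r)"
        by (cases r) (simp_all add: algebra_simps)
      show ?thesis
        using odd_coeff_recurrence[of m d "2 * int m + 1 - int r"]
        unfolding d_def[symmetric] l pred i by (simp only: diff_diff_eq)
    qed
    have "scale ?z (T l (2 * m + 1)) = act tU (T l (2 * m))"
      using arg_cong[OF t_ev_even_step, of "\<lambda>x. act x (v (2 * l))" m]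
      by (simp only: act_mult act_scale_left)
    also have "\<dots> = scale ?z (\<Sum>r\<le>2 * l. scale (odd_coeff (l - m) (2 * int m + 1 - int r)) (V (2 * l) r))"
      unfolding that(2) tU_sum_V coeff by (simp only: scale_sum_right scale_scale)
    finally show ?thesis by (simp only: scale_cancel_left) (simp add: qint_eq_0_iff)
  qed
  have even: "T l (2 * m) = (\<Sum>r\<le>2 * l. scale (even_coeff (l - m) (2 * int m - int r)) (V (2 * l) r))"
    if "m \<le> l" for m
    using that
  proof (induction m)
    case 0
    have "scale (even_coeff l (0 - int r)) (V (2 * l) r) = (if r = 0 then V (2 * l) 0 else 0)" for r
      by (simp add: even_coeff_neg)
    then show ?case by (simp add: act_one)
  next
    case (Suc m)
    let ?z = "qint (2 * int m + 2)" and ?w = "qint (2 * int m + 1)"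
    let ?c = "\<lambda>r. odd_coeff (l - m) (2 * int m + 1 - int r)" and ?e = "\<lambda>r. even_coeff (l - m) (2 * int m - int r)"
    have m: "m \<le> l" using Suc.prems by simp
    have IH: "T l (2 * m) = (\<Sum>r\<le>2 * l. scale (?e r) (V (2 * l) r))"
      using Suc by simp
    have coeff: "qint (int r) * ?c (r - 1) + qv powi (2 * int r - int (2 * l)) * ?c r
        + qv powi (2 * int r + 1 - int (2 * l)) * qint (int (2 * l) - int r) * ?c (Suc r)
        = ?z * even_coeff (l - Suc m) (2 * int (Suc m) - int r) + ?w * ?e r" for r
    proof -
      define d where "d = l - Suc m"
      have d: "l - m = Suc d" and l: "int (2 * l) = 2 * int m + 2 * int (Suc d)"
        using Suc.prems by (simp_all add: d_def)
      have i: "2 * int m + 2 - (2 * int m + 2 - int r) = int r"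
        "2 * int (Suc m) - int r = 2 * int m + 2 - int r"
        "2 * int m + 1 - int r = 2 * int m + 2 - int r - 1"
        "2 * int m - int r = 2 * int m + 2 - int r - 2"
        "2 * int m + 1 - int (Suc r) = 2 * int m + 2 - int r - 2" by simp_all
      have pred: "qint (int r) * odd_coeff (Suc d) (2 * int m + 1 - int (r - 1))
          = qint (int r) * odd_coeff (Suc d) (2 * int m + 2 - int r)"
        by (cases r) (simp_all add: algebra_simps)
      show ?thesis
        using even_coeff_recurrence[of m d "2 * int m + 2 - int r"]
        unfolding d_def[symmetric] d l pred i by (simp only: diff_diff_eq)
    qed
    have "scale ?z (T l (2 * m + 2)) + scale ?w (T l (2 * m)) = act tU (T l (2 * m + 1))"
      using arg_cong[OF t_ev_odd_step, of "\<lambda>x. act x (v (2 * l))" m]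
      by (simp only: act_mult act_scale_left act_add_left)
    also have "\<dots> = scale ?z (\<Sum>r\<le>2 * l. scale (even_coeff (l - Suc m) (2 * int (Suc m) - int r)) (V (2 * l) r))
        + scale ?w (T l (2 * m))"
      unfolding odd[OF m IH] tU_sum_V coeff
      unfolding IH by (simp only: scale_sum_right scale_scale scale_left_distrib sum.distrib)
    finally have "scale ?z (T l (2 * m + 2))
        = scale ?z (\<Sum>r\<le>2 * l. scale (even_coeff (l - Suc m) (2 * int (Suc m) - int r)) (V (2 * l) r))"
      by (simp only: add_right_cancel)
    moreover have "?z \<noteq> 0" by (simp add: qint_eq_0_iff)
    moreover have "2 * Suc m = 2 * m + 2" by simp
    ultimately show ?case by (simp only: scale_cancel_left) blast
  qed
  show "T l (2 * m) = (\<Sum>r\<le>2 * l. scale (even_coeff (l - m) (2 * int m - int r)) (V (2 * l) r))"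
    by (rule even[OF assms])
  then show "T l (2 * m + 1) = (\<Sum>r\<le>2 * l. scale (odd_coeff (l - m) (2 * int m + 1 - int r)) (V (2 * l) r))"
    by (rule odd[OF assms])
qed

lemma T_expansion:
  assumes "n \<le> 2 * l"
  shows "T l n = (\<Sum>r\<le>2 * l. scale (t_coeff l n r) (V (2 * l) r))"
proof (cases "even n")
  case True
  then obtain m where "n = 2 * m" by blast
  then show ?thesis using t_ev_expansion_aux(1)[of m l] assms by (simp add: t_coeff_def)
next
  case False
  then obtain m where "n = 2 * m + 1" by (rule oddE)
  then show ?thesis using t_ev_expansion_aux(2)[of m l] assms by (simp add: t_coeff_def add_ac)
qed

lemma T_top: "T l (2 * l + 1) = T l (2 * l)"
proof -
  have "odd_coeff 0 (2 * int l + 1 - int r) = even_coeff 0 (2 * int l - int r)" if "r \<in> {..2 * l}" for r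
    using odd_coeff_0_eq_even_coeff_0[of "2 * int l - int r"] that by (simp add: algebra_simps)
  then have "(\<Sum>r\<le>2 * l. scale (odd_coeff 0 (2 * int l + 1 - int r)) (V (2 * l) r))
      = (\<Sum>r\<le>2 * l. scale (even_coeff 0 (2 * int l - int r)) (V (2 * l) r))"
    by (intro sum.cong) simp_all
  then show ?thesis
    using t_ev_expansion_aux[of l l] by simp
qed

text \<open>For \<open>n = 2l + 2\<close> the recurrence reads
  \<open>[2l+2] t\<^sup>(\<^sup>2\<^sup>l\<^sup>+\<^sup>2\<^sup>)v = t \<cdot> t\<^sup>(\<^sup>2\<^sup>l\<^sup>)v - [2l+1] t\<^sup>(\<^sup>2\<^sup>l\<^sup>)v\<close> by \<open>T_top\<close>, and
  \<open>t \<cdot> t\<^sup>(\<^sup>2\<^sup>l\<^sup>)v = [2l+1] t\<^sup>(\<^sup>2\<^sup>l\<^sup>+\<^sup>1\<^sup>)v = [2l+1] t\<^sup>(\<^sup>2\<^sup>l\<^sup>)v\<close>.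
  For odd \<open>n\<close> only the vector for \<open>n - 1\<close> enters, so \<open>t\<^sup>(\<^sup>2\<^sup>l\<^sup>+\<^sup>1\<^sup>)v \<noteq> 0\<close> does no harm at \<open>n = 2l + 3\<close>.\<close>

lemma T_eq_0: "n \<ge> 2 * l + 2 \<Longrightarrow> T l n = 0"
proof (induction n rule: less_induct)
  case (less n)
  define k where "k = n - 2"
  have n: "n = Suc (Suc k)" and k: "k \<ge> 2 * l" using less.prems by (simp_all add: k_def)
  show ?case
  proof (cases "k = 2 * l")
    case True
    have "act tU (T l (2 * l)) = scale (qint (2 * int l + 1)) (T l (2 * l))"
      using arg_cong[OF t_ev_even_step, of "\<lambda>x. act x (v (2 * l))" l] T_top[of l]
      by (simp only: act_mult act_scale_left)
    then have "act (tU * t_ev (Suc k) - scaleU (qint (int (k + 1))) (t_ev k)) (v (2 * l)) = 0"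
      using T_top[of l] by (simp add: True act_mult act_diff_left act_scale_left add.commute)
    then show ?thesis by (simp add: n True act_scale_left)
  next
    case False
    then have "T l (Suc k) = 0" using less.IH[of "Suc k"] k n by simp
    moreover have "even k \<Longrightarrow> T l k = 0"
      using less.IH[of k] k n False by (cases "k = 2 * l + 1") auto
    ultimately show ?thesis
      by (simp add: n act_scale_left act_diff_left act_mult)
  qed
qed

section \<open>The \<open>\<iota>\<close>canonical basis of \<open>L(2\<lambda>)\<close>\<close>

lemma T_in_L: "T l n \<in> L (2 * l)"
  by (intro act_in_L v_in_L)

lemma T_sum_expansion:
  "(\<Sum>n\<le>2 * l. scale (a n) (T l n))
     = (\<Sum>r\<le>2 * l. scale (\<Sum>n\<le>2 * l. a n * t_coeff l n r) (V (2 * l) r))"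
proof -
  have "(\<Sum>n\<le>2 * l. scale (a n) (T l n))
      = (\<Sum>n\<le>2 * l. \<Sum>r\<le>2 * l. scale (a n * t_coeff l n r) (V (2 * l) r))"
    by (intro sum.cong refl) (simp add: T_expansion scale_sum_right)
  also have "\<dots> = (\<Sum>r\<le>2 * l. \<Sum>n\<le>2 * l. scale (a n * t_coeff l n r) (V (2 * l) r))"
    by (rule sum.swap)
  finally show ?thesis by (simp only: scale_sum_left)
qed

lemma T_sum_eq_0:
  assumes "(\<Sum>n\<le>2 * l. scale (a n) (T l n)) = 0" "n \<le> 2 * l"
  shows "a n = 0"
  using assms(2)
proof (induction n rule: downward_induct)
  case (top n)
  have "(\<Sum>k\<le>2 * l. a k * t_coeff l k n) = 0"
    by (rule V_sum_eq_0[OF _ top(1)]) (use assms(1) in \<open>simp only: T_sum_expansion\<close>)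
  then show ?case using sum_t_coeff_top[of n "2 * l" a l] top by simp
qed

lemma T_independent: "inj_on (T l) {..2 * l}" "independent (T l ` {..2 * l})"
proof -
  have zero: "a i = 0"
    if "finite A" "A \<subseteq> {..2 * l}" "(\<Sum>i\<in>A. scale (a i) (T l i)) = 0" "i \<in> A" for A a i
  proof -
    have "(\<Sum>n\<le>2 * l. scale (if n \<in> A then a n else 0) (T l n)) = (\<Sum>i\<in>A. scale (a i) (T l i))"
      using that(2) by (intro sum.mono_neutral_cong_right) auto
    then have "(if i \<in> A then a i else 0) = 0"
      using that by (intro T_sum_eq_0[where a = "\<lambda>n. if n \<in> A then a n else 0"]) auto
    then show ?thesis using that(4) by simp
  qed
  show "inj_on (T l) {..2 * l}" "independent (T l ` {..2 * l})"
    by (rule independent_imageI, rule zero; assumption)+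
qed

lemma span_T: "span (T l ` {..2 * l}) = L (2 * l)"
proof (rule antisym)
  show "span (T l ` {..2 * l}) \<subseteq> L (2 * l)"
    by (intro span_minimal subspace_L) (auto intro: T_in_L)
  have "V (2 * l) n \<in> span (T l ` {..2 * l})" if "n \<le> 2 * l" for n
    using that
  proof (induction n rule: less_induct)
    case (less n)
    have "T l n = (\<Sum>r\<in>{..2 * l} - {n}. scale (t_coeff l n r) (V (2 * l) r)) + V (2 * l) n"
      using less.prems by (simp add: T_expansion sum.remove[of _ n] add.commute)
    moreover have "scale (t_coeff l n r) (V (2 * l) r) \<in> span (T l ` {..2 * l})"
      if "r \<in> {..2 * l} - {n}" for r
    proof (cases "r < n")
      case True
      then show ?thesis using less.IH[of r] that by (intro span_scale) auto
    next
      case False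
      then show ?thesis using that t_coeff_upper[of n r l] by (simp add: span_zero)
    qed
    moreover have "T l n \<in> span (T l ` {..2 * l})"
      using less.prems by (intro span_base) auto
    ultimately show ?case
      by (metis (no_types, lifting) add_diff_cancel_left' span_diff span_sum)
  qed
  then have "span (V (2 * l) ` {..2 * l}) \<subseteq> span (T l ` {..2 * l})"
    by (intro span_minimal) auto
  then show "L (2 * l) \<subseteq> span (T l ` {..2 * l})" by (simp only: span_V)
qed

lemma L_T_cases:
  assumes "x \<in> L (2 * l)"
  obtains a where "x = (\<Sum>n\<le>2 * l. scale (a n) (T l n))"
  using assms span_image_finiteE[of "{..2 * l}" x "T l"] unfolding span_T by blast

subsection \<open>The bar involution\<close>

lemma L_closed:
  "x \<in> L \<mu> \<Longrightarrow> y \<in> L \<mu> \<Longrightarrow> x + y \<in> L \<mu>" "x \<in> L \<mu> \<Longrightarrow> scale c x \<in> L \<mu>"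
  "0 \<in> L \<mu>"
  using subspace_L[of \<mu>]
  by (auto intro: subspace_add subspace_scale subspace_0)

text \<open>The semilinear map that fixes the basis \<open>t\<^sup>(\<^sup>n\<^sup>)v\<close>, \<open>n \<le> 2\<lambda>\<close>. It fixes the remaining \<open>t\<^sup>(\<^sup>n\<^sup>)v\<close>
  as well, since each of them is 0 or equal to \<open>t\<^sup>(\<^sup>2\<^sup>\<lambda>\<^sup>)v\<close>.\<close>

lemma bar_involution_exists: "\<exists>\<psi>. is_bar_involution l \<psi>"
proof
  let ?B = "T l ` {..2 * l}"
  define \<psi> where "\<psi> x = (\<Sum>b\<in>?B. scale (bar (representation ?B x b)) b)" for x
  note rep = T_independent(2)[of l]
  have \<psi>_T: "\<psi> (T l n) = T l n" for n
  proof -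
    have "\<psi> (T l n) = T l n" if "n \<le> 2 * l" for n
    proof -
      have B: "T l n \<in> ?B" using that by auto
      have "scale (bar (representation ?B (T l n) b)) b = (if b = T l n then T l n else 0)" for b
        by (simp add: representation_basis[OF rep B])
      then show ?thesis using B by (simp add: \<psi>_def)
    qed
    moreover have "\<psi> 0 = 0"
      by (simp add: \<psi>_def representation_zero)
    moreover consider "n \<le> 2 * l" | "n = 2 * l + 1" | "n \<ge> 2 * l + 2" by linarith
    ultimately show ?thesis using T_top[of l] T_eq_0[of l n] by (metis order_refl)
  qed
  show "is_bar_involution l \<psi>"
    unfolding is_bar_involution_def
  proof (intro conjI ballI allI)
    show "\<psi> x \<in> L (2 * l)" for x
      unfolding \<psi>_def by (intro subspace_sum subspace_L L_closed) (auto intro: T_in_L)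
    show "\<psi> (x + y) = \<psi> x + \<psi> y" if "x \<in> L (2 * l)" "y \<in> L (2 * l)" for x y
      using that by (simp add: \<psi>_def representation_add[OF rep] span_T bar_add scale_left_distrib sum.distrib)
    show "\<psi> (scale (of_rat c) x) = scale (of_rat c) (\<psi> x)" if "x \<in> L (2 * l)" for c x
      using that by (simp add: \<psi>_def representation_scale[OF rep] span_T bar_mult scale_sum_right)
    show "\<psi> (scale qv x) = scale (inverse qv) (\<psi> x)" if "x \<in> L (2 * l)" for x
      using that by (simp add: \<psi>_def representation_scale[OF rep] span_T bar_mult scale_sum_right)
    show "\<psi> (T l n) = T l n" for n
      by (rule \<psi>_T)
  qed
qed

text \<open>Semilinearity is postulated for rational numbers and for \<open>q\<close> only. It extends to polynomials
  in \<open>q\<close>, and then to \<open>c = a/b\<close> by applying the polynomial case to \<open>b \<cdot> (c x) = a x\<close>.\<close>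

lemma bar_involution_scale:
  assumes \<psi>: "is_bar_involution l \<psi>" and x: "x \<in> L (2 * l)"
  shows "\<psi> (scale c x) = scale (bar c) (\<psi> x)"
proof -
  have poly: "\<psi> (scale (qeval qv p) y) = scale (qeval (inverse qv) p) (\<psi> y)" if y: "y \<in> L (2 * l)" for p y
  proof (induction p)
    case 0
    have "\<psi> (0 + 0) = \<psi> 0 + \<psi> 0"
      using \<psi> L_closed(3) unfolding is_bar_involution_def by blast
    then show ?case by simp
  next
    case (pCons a p)
    have "scale (qeval qv (pCons a p)) y = scale (of_rat a) y + scale qv (scale (qeval qv p) y)"
      by (simp add: scale_left_distrib)
    then have "\<psi> (scale (qeval qv (pCons a p)) y)
        = scale (of_rat a) (\<psi> y) + scale (inverse qv) (\<psi> (scale (qeval qv p) y))"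
      using \<psi> y by (simp only: is_bar_involution_def L_closed)
    then show ?case by (simp add: pCons scale_left_distrib)
  qed
  obtain a b where b: "b \<noteq> 0" and c: "c = to_fract a / to_fract b" by (rule ratfun_cases)
  have "scale (qeval (inverse qv) b) (\<psi> (scale c x)) = \<psi> (scale (qeval qv b) (scale c x))"
    by (rule poly[OF L_closed(2)[OF x], symmetric])
  also have "scale (qeval qv b) (scale c x) = scale (qeval qv a) x"
    using b by (simp add: c to_fract_eq_qeval)
  also have "\<psi> \<dots> = scale (qeval (inverse qv) a) (\<psi> x)"
    by (rule poly[OF x])
  finally have "scale (inverse (qeval (inverse qv) b)) (scale (qeval (inverse qv) b) (\<psi> (scale c x)))
      = scale (inverse (qeval (inverse qv) b)) (scale (qeval (inverse qv) a) (\<psi> x))"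
    by (simp only:)
  moreover have "bar c = qeval (inverse qv) a / qeval (inverse qv) b"
    unfolding c by (rule bar_quotient[OF b])
  ultimately show ?thesis
    using b by (simp add: divide_inverse mult.commute)
qed

lemma bar_involution_T_sum:
  assumes \<psi>: "is_bar_involution l \<psi>"
  shows "\<psi> (\<Sum>n\<in>A. scale (a n) (T l n)) = (\<Sum>n\<in>A. scale (bar (a n)) (T l n))"
proof -
  have \<psi>_0: "\<psi> 0 = 0"
    using bar_involution_scale[OF \<psi> L_closed(3), of 0] by simp
  show ?thesis
  proof (induction A rule: infinite_finite_induct)
    case (insert k A)
    have "(\<Sum>n\<in>A. scale (a n) (T l n)) \<in> L (2 * l)"
      by (intro subspace_sum subspace_L L_closed T_in_L)
    then have "\<psi> (scale (a k) (T l k) + (\<Sum>n\<in>A. scale (a n) (T l n)))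
        = \<psi> (scale (a k) (T l k)) + \<psi> (\<Sum>n\<in>A. scale (a n) (T l n))"
      using \<psi> L_closed(2)[OF T_in_L[where l = l and n = k]] unfolding is_bar_involution_def by blast
    moreover have "\<psi> (T l k) = T l k"
      using \<psi> unfolding is_bar_involution_def by blast
    ultimately show ?case
      using insert bar_involution_scale[OF \<psi> T_in_L] by simp
  qed (simp_all add: \<psi>_0)
qed

lemma bar_inv_T_sum:
  "bar_inv l (\<Sum>n\<le>2 * l. scale (a n) (T l n)) = (\<Sum>n\<le>2 * l. scale (bar (a n)) (T l n))"
  unfolding bar_inv_def
proof (rule the_equality)
  obtain \<psi> where "is_bar_involution l \<psi>"
    using bar_involution_exists by blast
  then show "\<exists>\<psi>. is_bar_involution l \<psi> \<and>
      (\<Sum>n\<le>2 * l. scale (bar (a n)) (T l n)) = \<psi> (\<Sum>n\<le>2 * l. scale (a n) (T l n))"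
    by (intro exI[of _ \<psi>] conjI bar_involution_T_sum[symmetric])
qed (use bar_involution_T_sum in blast)

subsection \<open>Existence and uniqueness\<close>

lemma T_lower:
  assumes "n \<le> 2 * l"
  shows "T l n = V (2 * l) n + (\<Sum>r\<le>2 * l. scale (if r < n then t_coeff l n r else 0) (V (2 * l) r))"
proof -
  have "scale (t_coeff l n r) (V (2 * l) r) = (if r = n then V (2 * l) n else 0)
      + scale (if r < n then t_coeff l n r else 0) (V (2 * l) r)" for r
    using t_coeff_upper[of n r l] by (cases r n rule: linorder_cases) auto
  then have "T l n = (\<Sum>r\<le>2 * l. (if r = n then V (2 * l) n else 0)
      + scale (if r < n then t_coeff l n r else 0) (V (2 * l) r))"
    unfolding T_expansion[OF assms] by (rule sum.cong[OF refl])
  also have "\<dots> = V (2 * l) n + (\<Sum>r\<le>2 * l. scale (if r < n then t_coeff l n r else 0) (V (2 * l) r))"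
    unfolding sum.distrib using assms by simp
  finally show ?thesis .
qed

lemma bar_inv_T: "n \<le> 2 * l \<Longrightarrow> bar_inv l (T l n) = T l n"
proof -
  assume "n \<le> 2 * l"
  then have "(\<Sum>k\<le>2 * l. scale (if k = n then 1 else 0) (T l k)) = T l n"
    and "(\<Sum>k\<le>2 * l. scale (bar (if k = n then 1 else 0)) (T l k)) = T l n"
    by (simp_all add: if_distrib[of bar] if_distrib[of "\<lambda>c. scale c _"] cong: if_cong)
  then show ?thesis using bar_inv_T_sum[of l "\<lambda>k. if k = n then 1 else 0"] by simp
qed

lemma T_is_icanonical_basis: "is_icanonical_basis l (T l)"
  unfolding is_icanonical_basis_def
proof (intro conjI allI impI)
  show "\<exists>c. (\<forall>r\<le>2 * l. c r \<in> qinv_Zqinv) \<and>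
      T l a = V (2 * l) a + (\<Sum>r\<le>2 * l. scale (c r) (V (2 * l) r))" if "a \<le> 2 * l" for a
    using T_lower[OF that] t_coeff_lower[of _ a l] that
    by (intro exI[of _ "\<lambda>r. if r < a then t_coeff l a r else 0"]) (auto simp: qinv_Zqinv_0)
qed (simp_all add: T_independent span_T bar_inv_T)

text \<open>Let \<open>\<beta>\<close> be the coefficients of \<open>b a - t\<^sup>(\<^sup>a\<^sup>)v\<close> in the basis \<open>t\<^sup>(\<^sup>n\<^sup>)v\<close>, and \<open>g\<close> those in the basis
  \<open>F\<^sup>(\<^sup>r\<^sup>)v\<close>. The \<open>\<beta> n\<close> are bar invariant, the \<open>g r\<close> lie in \<open>q\<^sup>-\<^sup>1\<int>[q\<^sup>-\<^sup>1]\<close>, and if \<open>\<beta>\<close> vanishes above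
  \<open>n\<close>, then \<open>\<beta> n = g n\<close>. So \<open>\<beta>\<close> vanishes from the top down.\<close>

lemma icanonical_basis_unique:
  assumes b: "is_icanonical_basis l b" and a: "a \<le> 2 * l"
  shows "b a = T l a"
proof -
  have "b a \<in> L (2 * l)"
    using b a span_base[of "b a" "b ` {..2 * l}"] unfolding is_icanonical_basis_def by auto
  then obtain \<alpha> where \<alpha>: "b a = (\<Sum>n\<le>2 * l. scale (\<alpha> n) (T l n))"
    by (rule L_T_cases)
  obtain c where c: "\<And>r. r \<le> 2 * l \<Longrightarrow> c r \<in> qinv_Zqinv"
    and bc: "b a = V (2 * l) a + (\<Sum>r\<le>2 * l. scale (c r) (V (2 * l) r))"
    using b a unfolding is_icanonical_basis_def by blast
  define \<beta> where "\<beta> n = \<alpha> n - (if n = a then 1 else 0)" for n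
  define g where "g r = c r - (if r < a then t_coeff l a r else 0)" for r
  have g: "g r \<in> qinv_Zqinv" if "r \<le> 2 * l" for r
    unfolding g_def using c[OF that] t_coeff_lower[of r a l] a
    by (intro qinv_Zqinv_diff) (simp_all add: qinv_Zqinv_0)
  have "(\<Sum>k\<le>2 * l. scale (if k = a then 1 else 0) (T l k)) = T l a"
    using a by (simp add: if_distrib[of "\<lambda>c. scale c _"] cong: if_cong)
  then have \<beta>: "b a - T l a = (\<Sum>n\<le>2 * l. scale (\<beta> n) (T l n))"
    by (simp add: \<alpha> \<beta>_def scale_left_diff_distrib sum_subtractf)
  have "b a - T l a = (\<Sum>r\<le>2 * l. scale (g r) (V (2 * l) r))"
    by (simp add: bc T_lower[OF a] g_def scale_left_diff_distrib sum_subtractf)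
  then have "(\<Sum>r\<le>2 * l. scale ((\<Sum>n\<le>2 * l. \<beta> n * t_coeff l n r) - g r) (V (2 * l) r)) = 0"
    using \<beta> T_sum_expansion[where a = \<beta> and l = l] by (simp add: scale_left_diff_distrib sum_subtractf)
  from V_sum_eq_0[OF this] have sum_\<beta>: "(\<Sum>n\<le>2 * l. \<beta> n * t_coeff l n r) = g r" if "r \<le> 2 * l" for r
    using that by (metis eq_iff_diff_eq_0)
  have bar_\<alpha>: "bar (\<alpha> n) = \<alpha> n" if "n \<le> 2 * l" for n
  proof -
    have "bar_inv l (b a) = b a"
      using b a unfolding is_icanonical_basis_def by blast
    then have "(\<Sum>n\<le>2 * l. scale (bar (\<alpha> n) - \<alpha> n) (T l n)) = 0"
      unfolding \<alpha> bar_inv_T_sum by (simp add: scale_left_diff_distrib sum_subtractf)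
    from T_sum_eq_0[OF this that] show ?thesis by simp
  qed
  have bar_\<beta>: "bar (\<beta> n) = \<beta> n" if "n \<le> 2 * l" for n
  proof -
    have "bar (\<beta> n) + bar (if n = a then 1 else 0) = bar (\<alpha> n)"
      by (simp only: bar_add[symmetric] \<beta>_def diff_add_cancel)
    then show ?thesis by (simp add: bar_\<alpha>[OF that] \<beta>_def split: if_splits)
  qed
  have "\<beta> n = 0" if "n \<le> 2 * l" for n
    using that
  proof (induction n rule: downward_induct)
    case (top n)
    then have "\<beta> n = g n"
      using sum_t_coeff_top[of n "2 * l" \<beta> l] sum_\<beta>[of n] by simp
    then show ?case
      using g[of n] bar_\<beta>[of n] top(1) qinv_Zqinv_bar_fixed[of "\<beta> n"] by simp
  qed
  then show ?thesis using \<beta> by simp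
qed

lemma icanonical_eq_T:
  assumes "n \<le> 2 * l"
  shows "icanonical l n = T l n"
  unfolding icanonical_def
proof (rule the_equality)
  show "\<exists>b. is_icanonical_basis l b \<and> T l n = b n"
    using T_is_icanonical_basis by blast
qed (use icanonical_basis_unique[OF _ assms] in blast)

section \<open>The \<open>\<iota>\<close>canonical basis of \<open>\<^bold>U\<^sup>\<iota>\<close>\<close>

text \<open>If \<open>l\<close> is so large that all indices in \<open>A\<close> are at most \<open>2l\<close>, then the \<open>t\<^sup>(\<^sup>n\<^sup>)v\<close> with \<open>n \<in> A\<close> are
  part of a basis of \<open>L(2l)\<close>.\<close>

lemma t_ev_sum_eq_0:
  assumes A: "finite A" and zero: "\<And>l. l \<ge> N \<Longrightarrow> act (\<Sum>n\<in>A. scaleU (a n) (t_ev n)) (v (2 * l)) = 0"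
    and n: "n \<in> A"
  shows "a n = 0"
proof -
  define l where "l = max N (Max A)"
  have A_le: "A \<subseteq> {..2 * l}"
    using Max_ge[OF A] by (fastforce simp: l_def)
  have "(\<Sum>n\<le>2 * l. scale (if n \<in> A then a n else 0) (T l n)) = (\<Sum>n\<in>A. scale (a n) (T l n))"
    using A_le by (intro sum.mono_neutral_cong_right) auto
  also have "\<dots> = 0"
    using zero[of l] by (simp add: l_def act_sum_left act_scale_left)
  finally have "(if n \<in> A then a n else 0) = 0"
    by (rule T_sum_eq_0) (use A_le n in auto)
  then show ?thesis using n by simp
qed

lemma t_ev_independent: "inj t_ev" "UQ.independent (range t_ev)"
proof -
  have zero: "a i = 0"
    if "finite A" "A \<subseteq> UNIV" "(\<Sum>i\<in>A. scaleU (a i) (t_ev i)) = 0" "i \<in> A" for A :: "nat set" and a i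
    by (rule t_ev_sum_eq_0[OF that(1) _ that(4), of 0]) (simp only: that(3) act_zero_left)
  show "inj t_ev" "UQ.independent (range t_ev)"
    by (rule UQ.independent_imageI, rule zero; assumption)+
qed

text \<open>An element of \<open>\<^bold>U\<^sup>\<iota>\<close> is determined by its action on the highest weight vectors of \<open>L(2\<lambda>)\<close> for
  large \<open>\<lambda>\<close>; hence a lift of \<open>b\<^sub>a\<close> is unique.\<close>

lemma Uiota_faithful:
  assumes "w \<in> Uiota" and zero: "\<And>l. l \<ge> N \<Longrightarrow> act w (v (2 * l)) = 0"
  shows "w = 0"
proof -
  have "w \<in> UQ.span (t_ev ` UNIV)"
    using assms(1) by (simp only: span_t_ev)
  then obtain A c where A: "finite A" and w: "w = (\<Sum>n\<in>A. scaleU (c n) (t_ev n))"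
    by (rule UQ.span_imageE)
  have "c n = 0" if "n \<in> A" for n
    by (rule t_ev_sum_eq_0[OF A _ that, of N]) (use zero in \<open>simp only: w\<close>)
  then show ?thesis by (simp add: w)
qed

lemma t_ev_is_icanonical_basis_Uiota: "is_icanonical_basis_Uiota t_ev"
  unfolding is_icanonical_basis_Uiota_def
proof (intro conjI allI impI)
  have t_ev: "t_ev n \<in> Uiota" for n
    unfolding span_t_ev[symmetric] by (rule UQ.span_base) (rule rangeI)
  fix a
  show "lifts_icanonical a (t_ev a)"
    unfolding lifts_icanonical_def using t_ev by (auto intro!: exI[of _ a] simp: icanonical_eq_T)
  fix w
  assume "lifts_icanonical a w"
  then obtain N where w: "w \<in> Uiota" and N: "\<And>l. l \<ge> N \<Longrightarrow> act w (v (2 * l)) = icanonical l a"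
    unfolding lifts_icanonical_def by blast
  have "w - t_ev a = 0"
  proof (rule Uiota_faithful)
    show "w - t_ev a \<in> Uiota"
      using w t_ev unfolding span_t_ev[symmetric] by (rule UQ.span_diff)
    show "act (w - t_ev a) (v (2 * l)) = 0" if "l \<ge> max N a" for l
      using N[of l] that by (simp add: act_diff_left icanonical_eq_T)
  qed
  then show "w = t_ev a" by simp
qed (rule t_ev_independent span_t_ev)+

end

theorem theorem4p5:
  fixes scale :: "ratfun \<Rightarrow> 'v::ab_group_add \<Rightarrow> 'v" and act :: "uq \<Rightarrow> 'v \<Rightarrow> 'v"
    and L :: "nat \<Rightarrow> 'v set" and v :: "nat \<Rightarrow> 'v"
  assumes "simple_hw_modules scale act L v"
  shows "(\<forall>l.
      simple_hw_modules.is_icanonical_basis scale act L v l (\<lambda>n. act (t_ev n) (v (2 * l))) \<and>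
      (\<forall>n\<le>2 * l. simple_hw_modules.icanonical scale act L v l n = act (t_ev n) (v (2 * l))) \<and>
      act (t_ev (2 * l + 1)) (v (2 * l)) = act (t_ev (2 * l)) (v (2 * l)) \<and>
      (\<forall>n\<ge>2 * l + 2. act (t_ev n) (v (2 * l)) = 0)) \<and>
    simple_hw_modules.is_icanonical_basis_Uiota scale act L v t_ev"
proof -
  interpret simple_hw_modules scale act L v by (rule assms)
  show ?thesis
    using T_is_icanonical_basis icanonical_eq_T T_top T_eq_0 t_ev_is_icanonical_basis_Uiota by blast
qed

end
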